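(* Let $M=\{X\in E: C(X)=0\}$ with $C'(X)$ onto $E_L$ for $X\in M$, let $\Pi:M\to\mathrm{Lin}(E,E)$ be a smooth projection function ($\Pi(X)^2=\Pi(X)$, $\Pi(X)$ of rank $\dim E-\dim E_L$), and let $F$ be a smooth function with $\Pi(X)F(X)=F(X)$ for $X\in M$. Let $X_*\in M$ with $F(X_* )=0$, let $\mathfrak r$ be a retraction around $X_*$, and assume that $\eta\mapsto\Pi(X_* )F'(X_* )\eta$ is invertible from $T_{X_*}$ to $\mathrm{Im}\,\Pi(X_* )$. For $X\in M$ and $\eta\in T_X$ set $$G(X;\eta^{[2]})=F^{(2)}(X;\eta^{[2]})+F'(X)\,\mathfrak r_{\eta\eta}(X,0;\eta^{[2]}).$$ (i) If $\Pi(X_* )G(X_*;\eta^{[2]})=0$ for all $\eta\in T_{X_*}$, then the iteration $X_{i+1}=\mathfrak r(X_i,\eta_i)$, where $\eta_i\in T_{X_i}$ solves $\Pi(X_i)F'(X_i)\eta_i=-F(X_i)$, converges cubically to $X_*$ when $X_0\in M$ is sufficiently close to $X_*$. (ii) (Without the vanishing assumption in (i).) The Rayleigh-Chebyshev iteration $$X_{i+1}=\mathfrak r\bigl(X_i,\ \eta_i-\tfrac12 X_i^{\tau}\bigr),$$ where $\eta_i\in T_{X_i}$ solves $\Pi(X_i)F'(X_i)\eta_i=-F(X_i)$ and $X_i^{\tau}\in T_{X_i}$ solves $\Pi(X_i)F'(X_i)X_i^{\tau}=\Pi(X_i)G(X_i;\eta_i^{[2]})$, converges cubically to $X_*$ for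 every initial point $X_0\in M$ sufficiently close to $X_*$. (iii) Suppose in addition that $F(X)=L(X,\mathcal R(X))$ arises from a generalized Rayleigh quotient, that is: $L:E\times E_L\to E$ is smooth; $L_\lambda^-(X,\lambda)\in\mathrm{Lin}(E,E_L)$ is a smoothly varying left inverse of the partial derivative $L_\lambda(X,\lambda)\in\mathrm{Lin}(E_L,E)$; $\mathcal R$ is a smooth $E_L$-valued function with $L_\lambda^-(X,\mathcal R(X))L(X,\mathcal R(X))=0$; and $\Pi(X)=I_E-L_\lambda(X,\mathcal R(X))L_\lambda^-(X,\mathcal R(X))$. Then (i) and (ii) also hold with $G$ replaced by $G_L$, where, with $\lambda=\mathcal R(X)$, $$G_L(X;\eta^{[2]})=L_{XX}(X,\lambda)\eta^{[2]}+2L_{X\lambda}(X,\lambda)[\eta,\mathcal R'(X;\eta)]+L_{\lambda\lambda}(X,\lambda)\mathcal R'(X;\eta)^{[2]}+L_X(X,\lambda)\,\mathfrak r_{\eta\eta}(X,0;\eta^{[2]}).$$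
   Context: $E$ and $E_L$ are finite-dimensional real inner product spaces, $\mathrm{Lin}(V,W)$ is the space of linear maps $V\to W$, $C:E\to E_L$ is smooth, $T_X=\mathrm{Null}(C'(X))$ is the tangent space of $M$ at $X$, and $TM=\{(X,\eta):X\in M,\eta\in T_X\}$. "Smooth" means sufficiently differentiable. $F$ and $\mathcal R$ are regarded as smoothly defined on a neighborhood of $M$ in $E$ (the identities involving $\Pi$ being required at points of $M$). $\eta^{[2]}$ means the argument $\eta$ is repeated twice in a bilinear map; $F'(X)$ and $F^{(2)}(X)$ are the Jacobian and the Hessian (bilinear map) of $F$, and subscripts denote partial derivatives. Retraction: a retraction around $X_f\in M$ is a smooth map $\mathfrak r$ from an open subset $\mathtt T_{\mathfrak r}\subset TM$ to $M$, whose range contains a neighborhood $\Omega\subset M$ of $X_f$, such that for some $\rho_{\mathfrak r}>0$ the set $\mathtt T_{\mathfrak r}$ contains all $(X,\eta)\in TM$ with $X\in\Omega$, $|\eta|<\rho_{\mathfrak r}$, and such that whenever $\mathfrak r(X,0)$ is defined, $\mathfrak r(X,0)=X$ and the derivative of $\eta\mapsto\mathfrak r(X,\eta)$ at $0$ is the identity of $T_X$. $\mathfrak r_{\eta\eta}(X,0;\eta^{[2]})\in E$ is the second derivative of the map $\mathfrak r(X,\cdot):T_X\to E$ at $0$ evaluated twice at $\eta$. Cubic convergence of $X_i$ to $X_*$: $X_i\to X_*$ and there is $M_0$ with $|X_{i+1}-X_*|\le M_0|X_i-X_*|^3$ for all large $i$. *)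

theory Defs
  imports "HOL-Analysis.Analysis"
begin

section \<open>Smoothness\<close>

text \<open>"Smooth" in the sense of "sufficiently differentiable" is rendered as three times
  continuously differentiable, in the Frechet sense with operator-valued derivatives.\<close>

definition C3_on :: "'a::real_normed_vector set \<Rightarrow> ('a \<Rightarrow> 'b::real_normed_vector) \<Rightarrow> bool" where
  "C3_on U f \<longleftrightarrow> open U \<and>
     (\<exists>(f1 :: 'a \<Rightarrow> 'a \<Rightarrow>\<^sub>L 'b) (f2 :: 'a \<Rightarrow> 'a \<Rightarrow>\<^sub>L 'a \<Rightarrow>\<^sub>L 'b) (f3 :: 'a \<Rightarrow> 'a \<Rightarrow>\<^sub>L 'a \<Rightarrow>\<^sub>L 'a \<Rightarrow>\<^sub>L 'b).
        (\<forall>x\<in>U. (f has_derivative blinfun_apply (f1 x)) (at x)) \<and>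
        (\<forall>x\<in>U. (f1 has_derivative blinfun_apply (f2 x)) (at x)) \<and>
        (\<forall>x\<in>U. (f2 has_derivative blinfun_apply (f3 x)) (at x)) \<and>
        continuous_on U f3)"

text \<open>Smoothness of a map on a subset of the ambient space that need not be open (such as a
  submanifold): near each point the map is the restriction of a smooth map on an open set.\<close>

definition C3_on_subset :: "'a::real_normed_vector set \<Rightarrow> ('a \<Rightarrow> 'b::real_normed_vector) \<Rightarrow> bool" where
  "C3_on_subset S f \<longleftrightarrow>
     (\<forall>x\<in>S. \<exists>U g. x \<in> U \<and> C3_on U g \<and> (\<forall>y\<in>S \<inter> U. f y = g y))"

text \<open>The second derivative of \<open>f\<close> at \<open>x\<close> along \<open>S\<close>, as a bilinear map.  If \<open>S\<close> is a proper
  subspace, the derivatives within \<open>S\<close> are determined only on \<open>S\<close>; hence \<open>u\<close> and \<open>v\<close> have to lie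
  in \<open>S\<close>.\<close>

definition second_derivative ::
  "('a::real_normed_vector \<Rightarrow> 'b::real_normed_vector) \<Rightarrow> 'a set \<Rightarrow> 'a \<Rightarrow> 'a \<Rightarrow> 'a \<Rightarrow> 'b" where
  "second_derivative f S x u v =
     frechet_derivative (\<lambda>y. frechet_derivative f (at y within S) u) (at x within S) v"


section \<open>Constraint manifold, projection functions, retractions\<close>

definition constraint_set :: "('e::euclidean_space \<Rightarrow> 'l::real_inner) \<Rightarrow> 'e set" where
  "constraint_set C = {X. C X = 0}"

definition tangent_space :: "('e::euclidean_space \<Rightarrow> 'l::real_inner) \<Rightarrow> 'e \<Rightarrow> 'e set" where
  "tangent_space C X = {\<eta>. frechet_derivative C (at X) \<eta> = 0}"

definition tangent_bundle :: "('e::euclidean_space \<Rightarrow> 'l::real_inner) \<Rightarrow> ('e \<times> 'e) set" where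
  "tangent_bundle C = {(X, \<eta>). X \<in> constraint_set C \<and> \<eta> \<in> tangent_space C X}"

text \<open>The multiplier space is a type of class \<open>real_inner\<close> with a finite spanning set rather than
  of class \<open>euclidean_space\<close>, because the latter would exclude dimension zero (no constraints).\<close>

definition finite_dimensional :: "'l::real_vector itself \<Rightarrow> bool" where
  "finite_dimensional _ \<longleftrightarrow> (\<exists>B::'l set. finite B \<and> span B = UNIV)"

definition projection_function ::
  "('e::euclidean_space \<Rightarrow> 'l::real_inner) \<Rightarrow> ('e \<Rightarrow> 'e \<Rightarrow>\<^sub>L 'e) \<Rightarrow> bool" where
  "projection_function C Proj \<longleftrightarrow>
     C3_on_subset (constraint_set C) Proj \<and>
     (\<forall>X\<in>constraint_set C. Proj X o\<^sub>L Proj X = Proj X \<and>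
        dim (range (blinfun_apply (Proj X))) = DIM('e) - dim (UNIV :: 'l set))"

definition retraction_around ::
  "('e::euclidean_space \<Rightarrow> 'l::real_inner) \<Rightarrow> ('e \<times> 'e) set \<Rightarrow> ('e \<times> 'e \<Rightarrow> 'e) \<Rightarrow> 'e \<Rightarrow> bool" where
  "retraction_around C T r Xf \<longleftrightarrow>
     openin (top_of_set (tangent_bundle C)) T \<and>
     C3_on_subset T r \<and>
     r ` T \<subseteq> constraint_set C \<and>
     (\<exists>\<Omega> \<rho>. openin (top_of_set (constraint_set C)) \<Omega> \<and> Xf \<in> \<Omega> \<and> \<Omega> \<subseteq> r ` T \<and>
        \<rho> > 0 \<and> {(X, \<eta>) \<in> tangent_bundle C. X \<in> \<Omega> \<and> norm \<eta> < \<rho>} \<subseteq> T) \<and>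
     (\<forall>X. (X, 0) \<in> T \<longrightarrow> r (X, 0) = X \<and>
        ((\<lambda>\<eta>. r (X, \<eta>)) has_derivative (\<lambda>\<eta>. \<eta>)) (at 0 within tangent_space C X))"

definition retraction_etaeta ::
  "('e::euclidean_space \<Rightarrow> 'l::real_inner) \<Rightarrow> ('e \<times> 'e \<Rightarrow> 'e) \<Rightarrow> 'e \<Rightarrow> 'e \<Rightarrow> 'e" where
  "retraction_etaeta C r X \<eta> = second_derivative (\<lambda>\<xi>. r (X, \<xi>)) (tangent_space C X) 0 \<eta> \<eta>"


section \<open>The quadratic forms G and GL\<close>

definition G_form ::
  "('e::euclidean_space \<Rightarrow> 'l::real_inner) \<Rightarrow> ('e \<times> 'e \<Rightarrow> 'e) \<Rightarrow> ('e \<Rightarrow> 'e) \<Rightarrow> 'e \<Rightarrow> 'e \<Rightarrow> 'e" where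
  "G_form C r F X \<eta> =
     second_derivative F UNIV X \<eta> \<eta> + frechet_derivative F (at X) (retraction_etaeta C r X \<eta>)"

definition deriv_X ::
  "('e::euclidean_space \<times> 'l::real_inner \<Rightarrow> 'e) \<Rightarrow> 'e \<Rightarrow> 'l \<Rightarrow> 'e \<Rightarrow> 'e" where
  "deriv_X L X l \<eta> = frechet_derivative (\<lambda>Y. L (Y, l)) (at X) \<eta>"

definition deriv_lam ::
  "('e::euclidean_space \<times> 'l::real_inner \<Rightarrow> 'e) \<Rightarrow> 'e \<Rightarrow> 'l \<Rightarrow> 'l \<Rightarrow> 'e" where
  "deriv_lam L X l \<mu> = frechet_derivative (\<lambda>m. L (X, m)) (at l) \<mu>"

definition deriv_X_lam ::
  "('e::euclidean_space \<times> 'l::real_inner \<Rightarrow> 'e) \<Rightarrow> 'e \<Rightarrow> 'l \<Rightarrow> 'e \<Rightarrow> 'l \<Rightarrow> 'e" where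
  "deriv_X_lam L X l \<eta> \<mu> = frechet_derivative (\<lambda>Y. deriv_lam L Y l \<mu>) (at X) \<eta>"

definition GL_form ::
  "('e::euclidean_space \<Rightarrow> 'l::real_inner) \<Rightarrow> ('e \<times> 'e \<Rightarrow> 'e) \<Rightarrow> ('e \<times> 'l \<Rightarrow> 'e) \<Rightarrow> ('e \<Rightarrow> 'l) \<Rightarrow>
   'e \<Rightarrow> 'e \<Rightarrow> 'e" where
  "GL_form C r L R X \<eta> =
     (let l = R X; \<mu> = frechet_derivative R (at X) \<eta> in
        second_derivative (\<lambda>Y. L (Y, l)) UNIV X \<eta> \<eta>
        + 2 *\<^sub>R deriv_X_lam L X l \<eta> \<mu>
        + second_derivative (\<lambda>m. L (X, m)) UNIV l \<mu> \<mu>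
        + deriv_X L X l (retraction_etaeta C r X \<eta>))"

text \<open>The left inverse \<open>Lm\<close> is only required on an open set \<open>W\<close> containing the graph of \<open>R\<close> over the
  manifold; for the eigenvalue problem, \<open>L (X, l) = A X - l X\<close>, no left inverse exists at
  \<open>X = 0\<close>.  With \<open>W = UNIV\<close> one gets globally defined left inverses.\<close>

definition generalized_rayleigh ::
  "('e::euclidean_space \<Rightarrow> 'l::real_inner) \<Rightarrow> ('e \<Rightarrow> 'e \<Rightarrow>\<^sub>L 'e) \<Rightarrow> ('e \<Rightarrow> 'e) \<Rightarrow>
   ('e \<times> 'l \<Rightarrow> 'e) \<Rightarrow> ('e \<times> 'l \<Rightarrow> 'e \<Rightarrow>\<^sub>L 'l) \<Rightarrow> ('e \<Rightarrow> 'l) \<Rightarrow> bool" where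
  "generalized_rayleigh C Proj F L Lm R \<longleftrightarrow>
     C3_on UNIV L \<and>
     (\<exists>N. constraint_set C \<subseteq> N \<and> C3_on N R) \<and>
     (\<exists>W. (\<forall>X\<in>constraint_set C. (X, R X) \<in> W) \<and> C3_on W Lm \<and>
        (\<forall>(X, l)\<in>W. \<forall>\<mu>. blinfun_apply (Lm (X, l)) (deriv_lam L X l \<mu>) = \<mu>)) \<and>
     (\<forall>X\<in>constraint_set C.
        F X = L (X, R X) \<and>
        blinfun_apply (Lm (X, R X)) (L (X, R X)) = 0 \<and>
        (\<forall>v. blinfun_apply (Proj X) v = v - deriv_lam L X (R X) (blinfun_apply (Lm (X, R X)) v)))"


section \<open>The iterations and local cubic convergence\<close>

definition solves_projected ::
  "('e::euclidean_space \<Rightarrow> 'l::real_inner) \<Rightarrow> ('e \<Rightarrow> 'e \<Rightarrow>\<^sub>L 'e) \<Rightarrow> ('e \<Rightarrow> 'e) \<Rightarrow> 'e \<Rightarrow> 'e \<Rightarrow> 'e \<Rightarrow> bool" where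
  "solves_projected C Proj F X b \<eta> \<longleftrightarrow>
     \<eta> \<in> tangent_space C X \<and> blinfun_apply (Proj X) (frechet_derivative F (at X) \<eta>) = b"

definition newton_update ::
  "('e::euclidean_space \<Rightarrow> 'l::real_inner) \<Rightarrow> ('e \<Rightarrow> 'e \<Rightarrow>\<^sub>L 'e) \<Rightarrow> ('e \<Rightarrow> 'e) \<Rightarrow> 'e \<Rightarrow> 'e \<Rightarrow> bool" where
  "newton_update C Proj F X \<xi> \<longleftrightarrow> solves_projected C Proj F X (- F X) \<xi>"

definition chebyshev_update ::
  "('e::euclidean_space \<Rightarrow> 'l::real_inner) \<Rightarrow> ('e \<Rightarrow> 'e \<Rightarrow>\<^sub>L 'e) \<Rightarrow> ('e \<Rightarrow> 'e) \<Rightarrow> ('e \<Rightarrow> 'e \<Rightarrow> 'e) \<Rightarrow>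
   'e \<Rightarrow> 'e \<Rightarrow> bool" where
  "chebyshev_update C Proj F G X \<xi> \<longleftrightarrow>
     (\<exists>\<eta> \<tau>. solves_projected C Proj F X (- F X) \<eta> \<and>
            solves_projected C Proj F X (blinfun_apply (Proj X) (G X \<eta>)) \<tau> \<and>
            \<xi> = \<eta> - (1/2) *\<^sub>R \<tau>)"

definition converges_cubically :: "(nat \<Rightarrow> 'e::real_normed_vector) \<Rightarrow> 'e \<Rightarrow> bool" where
  "converges_cubically X Xs \<longleftrightarrow>
     X \<longlonglongrightarrow> Xs \<and>
     (\<exists>M0::real. \<forall>\<^sub>F i in sequentially. norm (X (Suc i) - Xs) \<le> M0 * norm (X i - Xs) ^ 3)"

definition is_iteration ::
  "('e \<times> 'e \<Rightarrow> 'e) \<Rightarrow> ('e \<Rightarrow> 'e \<Rightarrow> bool) \<Rightarrow> (nat \<Rightarrow> 'e) \<Rightarrow> (nat \<Rightarrow> 'e) \<Rightarrow> bool" where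
  "is_iteration r upd X \<xi> \<longleftrightarrow> (\<forall>i. upd (X i) (\<xi> i) \<and> X (Suc i) = r (X i, \<xi> i))"

text \<open>For initial points close to the limit the iteration is well defined -- it exists, each update
  is uniquely determined and lies in the domain of the retraction -- and converges cubically.
  Membership in \<open>T\<close> is a conclusion, not part of \<open>is_iteration\<close>, since \<open>r\<close> is a total function in
  HOL.\<close>

definition locally_cubically_convergent ::
  "('e::euclidean_space \<Rightarrow> 'l::real_inner) \<Rightarrow> ('e \<times> 'e) set \<Rightarrow> ('e \<times> 'e \<Rightarrow> 'e) \<Rightarrow>
   ('e \<Rightarrow> 'e \<Rightarrow> bool) \<Rightarrow> 'e \<Rightarrow> bool" where
  "locally_cubically_convergent C T r upd Xs \<longleftrightarrow>
     (\<exists>\<delta>>0. \<forall>X0\<in>constraint_set C. dist X0 Xs < \<delta> \<longrightarrow>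
        (\<exists>X \<xi>. X 0 = X0 \<and> is_iteration r upd X \<xi>) \<and>
        (\<forall>X \<xi>. X 0 = X0 \<and> is_iteration r upd X \<xi> \<longrightarrow>
           (\<forall>i. (X i, \<xi> i) \<in> T \<and> (\<exists>!\<zeta>. upd (X i) \<zeta>)) \<and>
           converges_cubically X Xs))"

end

theory Submission
  imports Defs
begin

text \<open>
Write \<open>e\<close> for the distance of a point \<open>X\<close> of the constraint manifold \<open>M\<close> from the zero \<open>Xs\<close>.
The distance of the next iterate \<open>Y\<close> from \<open>Xs\<close> is controlled by its projected residual:
\<open>Y - Xs\<close> is tangent to second order because \<open>C\<close> vanishes at both points, and on the tangent
space the derivative of \<open>F\<close>, followed by the projection, is invertible; hence
\<open>norm (Y - Xs) \<le> K * norm (Proj X (F Y))\<close> for all \<open>X\<close>, \<open>Y\<close> in \<open>M\<close> near \<open>Xs\<close>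
(lemma \<open>distance_bounded\<close>).  A step is therefore of third order as soon as the projected residual
of the new point is \<open>O(e ^ 3)\<close>.

Along the retraction the projected residual has the expansion
\<open>Proj X (F (r (X, \<xi>))) = F X + Proj X (F' X \<xi>) + 1/2 Proj X (B X \<xi> \<xi>) + O(norm \<xi> ^ 3)\<close>,
where \<open>B X\<close> is a bilinear map with \<open>B X \<xi> \<xi> = G X \<xi>\<close> for tangent \<open>\<xi>\<close>
(definitions \<open>quadratic_model\<close> and \<open>represents\<close>).  The increments are
\<open>O(e)\<close>, so everything depends on making the quadratic polynomial on the right \<open>O(e ^ 3)\<close>
(lemma \<open>third_order_step\<close>).

For Newton's increment \<open>\<eta>\<close> the affine part vanishes and \<open>1/2 Proj X (B X \<eta> \<eta>)\<close> remains.  If it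
vanishes on the tangent space at \<open>Xs\<close>, it is \<open>O(e * norm \<eta> ^ 2)\<close>, because \<open>B\<close>, the projection and
the tangent space all change by \<open>O(e)\<close> (lemma \<open>vanishing_model\<close>).  For the Chebyshev increment
\<open>\<eta> - \<tau>/2\<close> the correction cancels \<open>1/2 Proj X (B X \<eta> \<eta>)\<close>; what is left are values of \<open>B X\<close> with at
least one argument \<open>\<tau> = O(e ^ 2)\<close>.

The form \<open>G\<close> is obtained by composing the Taylor expansions of \<open>F\<close> and of the retraction.  For a
generalized Rayleigh quotient one expands \<open>L (Y, R Y)\<close> instead.  The term
\<open>L\<^sub>\<lambda> (R Y - R X)\<close> is annihilated exactly by \<open>Proj X\<close>, so the second derivative of \<open>R\<close> never enters,
and the remaining quadratic terms are those of \<open>GL\<close> (lemma \<open>BL_model\<close>).  Both forms are thus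
quadratic models, and the two convergence statements are proved once, for an arbitrary quadratic
model.
\<close>

section \<open>Elementary estimates\<close>

lemma eventually_small:
  fixes a K :: real
  assumes "0 < a"
  shows "\<forall>\<^sub>F x in nhds x0. K * norm (x - x0) < a"
proof -
  have "((\<lambda>x. K * norm (x - x0)) \<longlongrightarrow> K * norm (x0 - x0)) (nhds x0)"
    by (intro tendsto_mult tendsto_const tendsto_norm tendsto_diff filterlim_ident)
  then have "((\<lambda>x. K * norm (x - x0)) \<longlongrightarrow> 0) (nhds x0)" by simp
  then show ?thesis using assms by (rule order_tendstoD)
qed

lemma norm_blinfun_le:
  assumes "norm A \<le> a" "norm v \<le> b"
  shows "norm (blinfun_apply A v) \<le> a * b"
  using order_trans[OF norm_blinfun mult_mono[OF assms order_trans[OF norm_ge_zero assms(1)] norm_ge_zero]] .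

section \<open>Taylor estimates on a ball\<close>

text \<open>All estimates below are local, so a smooth map enters the proof only through its first two
  derivatives on one ball together with one constant that bounds them and is a Lipschitz constant
  of the second.  Using a single constant keeps the error terms short.\<close>

locale taylor_ball =
  fixes f :: "'a::real_normed_vector \<Rightarrow> 'b::real_normed_vector"
    and f1 :: "'a \<Rightarrow> 'a \<Rightarrow>\<^sub>L 'b" and f2 :: "'a \<Rightarrow> 'a \<Rightarrow>\<^sub>L 'a \<Rightarrow>\<^sub>L 'b"
    and x0 :: 'a and d K :: real
  assumes d_pos: "0 < d" and K_nonneg: "0 \<le> K"
    and D1: "x \<in> ball x0 d \<Longrightarrow> (f has_derivative blinfun_apply (f1 x)) (at x)"
    and D2: "x \<in> ball x0 d \<Longrightarrow> (f1 has_derivative blinfun_apply (f2 x)) (at x)"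
    and bound1: "x \<in> ball x0 d \<Longrightarrow> norm (f1 x) \<le> K"
    and bound2: "x \<in> ball x0 d \<Longrightarrow> norm (f2 x) \<le> K"
    and lip2: "x \<in> ball x0 d \<Longrightarrow> y \<in> ball x0 d \<Longrightarrow> norm (f2 y - f2 x) \<le> K * norm (y - x)"
begin

lemma center: "x0 \<in> ball x0 d"
  using d_pos by simp

lemma near: "\<forall>\<^sub>F x in nhds x0. x \<in> ball x0 d"
  by (rule eventually_nhds_in_open[OF open_ball center])

lemma lip0:
  assumes "x \<in> ball x0 d" "y \<in> ball x0 d"
  shows "norm (f y - f x) \<le> K * norm (y - x)"
proof (rule differentiable_bound[OF convex_ball _ _ assms(2,1)])
  show "(f has_derivative blinfun_apply (f1 z)) (at z within ball x0 d)" if "z \<in> ball x0 d" for z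
    using D1[OF that] has_derivative_at_withinI by blast
  show "onorm (blinfun_apply (f1 z)) \<le> K" if "z \<in> ball x0 d" for z
    using bound1[OF that] by (simp add: norm_blinfun.rep_eq)
qed

lemma lip1:
  assumes "x \<in> ball x0 d" "y \<in> ball x0 d"
  shows "norm (f1 y - f1 x) \<le> K * norm (y - x)"
proof (rule differentiable_bound[OF convex_ball _ _ assms(2,1)])
  show "(f1 has_derivative blinfun_apply (f2 z)) (at z within ball x0 d)" if "z \<in> ball x0 d" for z
    using D2[OF that] has_derivative_at_withinI by blast
  show "onorm (blinfun_apply (f2 z)) \<le> K" if "z \<in> ball x0 d" for z
    using bound2[OF that] by (simp add: norm_blinfun.rep_eq)
qed

lemma segment_in_ball:
  assumes "x \<in> ball x0 d" "y \<in> ball x0 d" "t \<in> {0..1}"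
  shows "x + t *\<^sub>R (y - x) \<in> ball x0 d"
proof -
  have "x + t *\<^sub>R (y - x) = (1 - t) *\<^sub>R x + t *\<^sub>R y"
    by (simp add: algebra_simps)
  also have "\<dots> \<in> ball x0 d"
    using assms by (intro convexD[OF convex_ball]) auto
  finally show ?thesis .
qed

lemma rem0:
  assumes "x \<in> ball x0 d" "y \<in> ball x0 d"
  shows "norm (f y - f x - f1 x (y - x)) \<le> K * norm (y - x) ^ 2"
proof -
  let ?S = "(\<lambda>t. x + t *\<^sub>R (y - x)) ` {0..1}"
  have S: "?S \<subseteq> ball x0 d" using segment_in_ball[OF assms] by blast
  have "norm (f y - f x - f1 x (y - x)) \<le> norm (y - x) * (K * norm (y - x))"
  proof (rule differentiable_bound_linearization[where S = "?S" and f = f and a = x and b = y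
        and ?x0.0 = x and f' = "\<lambda>z. blinfun_apply (f1 z)"])
    show "(f has_derivative blinfun_apply (f1 z)) (at z within ?S)" if "z \<in> ?S" for z
      using D1[OF subsetD[OF S that]] has_derivative_at_withinI by blast
    show "onorm (blinfun_apply (f1 z) - blinfun_apply (f1 x)) \<le> K * norm (y - x)" if z: "z \<in> ?S" for z
    proof -
      obtain t where t: "z = x + t *\<^sub>R (y - x)" "t \<in> {0..1}" using z by (rule imageE)
      have "norm (f1 z - f1 x) \<le> K * norm (z - x)"
        using lip1[OF assms(1) subsetD[OF S z]] .
      also have "norm (z - x) \<le> norm (y - x)"
        using t mult_right_mono[of t 1 "norm (y - x)"] by simp
      finally have "norm (f1 z - f1 x) \<le> K * norm (y - x)"
        using K_nonneg by (simp add: mult_left_mono)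
      moreover have "blinfun_apply (f1 z) - blinfun_apply (f1 x) = blinfun_apply (f1 z - f1 x)"
        by (simp add: fun_eq_iff blinfun.diff_left)
      ultimately show ?thesis by (simp add: norm_blinfun.rep_eq)
    qed
    show "x \<in> ?S" by (rule image_eqI[of _ _ 0]) auto
  qed blast
  then show ?thesis by (simp add: power2_eq_square mult.left_commute)
qed

lemma rem1:
  assumes "x \<in> ball x0 d" "y \<in> ball x0 d"
  shows "norm (f1 y - f1 x - f2 x (y - x)) \<le> K * norm (y - x) ^ 2"
proof -
  let ?S = "(\<lambda>t. x + t *\<^sub>R (y - x)) ` {0..1}"
  have S: "?S \<subseteq> ball x0 d" using segment_in_ball[OF assms] by blast
  have "norm (f1 y - f1 x - f2 x (y - x)) \<le> norm (y - x) * (K * norm (y - x))"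
  proof (rule differentiable_bound_linearization[where S = "?S" and f = f1 and a = x and b = y
        and ?x0.0 = x and f' = "\<lambda>z. blinfun_apply (f2 z)"])
    show "(f1 has_derivative blinfun_apply (f2 z)) (at z within ?S)" if "z \<in> ?S" for z
      using D2[OF subsetD[OF S that]] has_derivative_at_withinI by blast
    show "onorm (blinfun_apply (f2 z) - blinfun_apply (f2 x)) \<le> K * norm (y - x)" if z: "z \<in> ?S" for z
    proof -
      obtain t where t: "z = x + t *\<^sub>R (y - x)" "t \<in> {0..1}" using z by (rule imageE)
      have "norm (f2 z - f2 x) \<le> K * norm (z - x)"
        using lip2[OF assms(1) subsetD[OF S z]] .
      also have "norm (z - x) \<le> norm (y - x)"
        using t mult_right_mono[of t 1 "norm (y - x)"] by simp
      finally have "norm (f2 z - f2 x) \<le> K * norm (y - x)"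
        using K_nonneg by (simp add: mult_left_mono)
      moreover have "blinfun_apply (f2 z) - blinfun_apply (f2 x) = blinfun_apply (f2 z - f2 x)"
        by (simp add: fun_eq_iff blinfun.diff_left)
      ultimately show ?thesis by (simp add: norm_blinfun.rep_eq)
    qed
    show "x \<in> ?S" by (rule image_eqI[of _ _ 0]) auto
  qed blast
  then show ?thesis by (simp add: power2_eq_square mult.left_commute)
qed

text \<open>The estimate is integrated along the segment, where only the value of the second derivative on
  the diagonal occurs; its symmetry is not presupposed and is derived from this lemma below.\<close>

lemma taylor2:
  assumes "x \<in> ball x0 d" "y \<in> ball x0 d"
  shows "norm (f y - f x - f1 x (y - x) - (1/2) *\<^sub>R f2 x (y - x) (y - x)) \<le> K * norm (y - x) ^ 3"
proof -
  define w where "w = y - x"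
  define c where "c t = f (x + t *\<^sub>R w) - t *\<^sub>R f1 x w - (t\<^sup>2 / 2) *\<^sub>R f2 x w w" for t :: real
  have seg: "x + t *\<^sub>R w \<in> ball x0 d" if "t \<in> {0..1}" for t
    using segment_in_ball[OF assms that] by (simp add: w_def)
  have "norm (c 1 - c 0) \<le> (K * norm w ^ 3) * norm (1 - (0::real))"
  proof (rule differentiable_bound[where S = "{0..1::real}"])
    fix t :: real assume t: "t \<in> {0..1}"
    let ?c' = "f1 (x + t *\<^sub>R w) w - f1 x w - t *\<^sub>R f2 x w w"
    have *: "((\<lambda>t. f (x + t *\<^sub>R w)) has_derivative (\<lambda>h. f1 (x + t *\<^sub>R w) (h *\<^sub>R w))) (at t within {0..1})"
      by (rule has_derivative_compose[where f = "\<lambda>t. x + t *\<^sub>R w" and f' = "\<lambda>h. h *\<^sub>R w",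
            OF _ D1[OF seg[OF t]]])
        (auto intro!: derivative_eq_intros)
    show "(c has_derivative (\<lambda>h. h *\<^sub>R ?c')) (at t within {0..1})"
    proof -
      have "(c has_derivative (\<lambda>h. f1 (x + t *\<^sub>R w) (h *\<^sub>R w) - h *\<^sub>R f1 x w
          - (t * h) *\<^sub>R f2 x w w)) (at t within {0..1})"
        unfolding c_def by (intro has_derivative_diff *) (auto intro!: derivative_eq_intros)
      then show ?thesis by (simp add: blinfun.bilinear_simps algebra_simps)
    qed
    have "norm ?c' = norm ((f1 (x + t *\<^sub>R w) - f1 x - f2 x (t *\<^sub>R w)) w)"
      by (simp add: blinfun.bilinear_simps)
    also have "\<dots> \<le> norm (f1 (x + t *\<^sub>R w) - f1 x - f2 x (t *\<^sub>R w)) * norm w"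
      by (rule norm_blinfun)
    also have "norm (f1 (x + t *\<^sub>R w) - f1 x - f2 x (t *\<^sub>R w)) \<le> K * norm (t *\<^sub>R w) ^ 2"
      using rem1[OF assms(1) seg[OF t]] by simp
    also have "K * norm (t *\<^sub>R w) ^ 2 \<le> K * norm w ^ 2"
      using t K_nonneg by (intro mult_left_mono power_mono) (auto simp: mult_left_le_one_le)
    finally have "norm ?c' \<le> (K * norm w ^ 2) * norm w"
      by (simp add: mult_right_mono)
    then have le: "norm ?c' \<le> K * norm w ^ 3"
      by (simp add: power3_eq_cube power2_eq_square mult.assoc)
    show "onorm (\<lambda>h. h *\<^sub>R ?c') \<le> K * norm w ^ 3"
    proof (rule onorm_le)
      fix h :: real
      show "norm (h *\<^sub>R ?c') \<le> K * norm w ^ 3 * norm h"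
        using mult_left_mono[OF le abs_ge_zero[of h]] by (simp only: norm_scaleR real_norm_def mult.commute)
    qed
  qed auto
  moreover have "c 1 - c 0 = f y - f x - f1 x (y - x) - (1/2) *\<^sub>R f2 x (y - x) (y - x)"
    by (simp add: c_def w_def)
  ultimately show ?thesis by (simp add: w_def)
qed

text \<open>The mixed second difference of \<open>f\<close> is symmetric in its two increments, and by the Taylor
  estimate it differs from either order of the second derivative by a third-order term.\<close>

lemma symmetric:
  assumes x: "x \<in> ball x0 d"
  shows "f2 x u v = f2 x v u"
proof -
  obtain e where e: "e > 0" "ball x e \<subseteq> ball x0 d"
    using x open_ball open_contains_ball by blast
  define m where "m = norm u + norm v + 1"
  have m: "m > 0" "norm u \<le> m" "norm v \<le> m"
    by (simp_all add: m_def add_nonneg_pos)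
  have *: "norm (f (x + (a + b)) - f (x + a) - f (x + b) + f x - f2 x a b) \<le> 4 * K * n ^ 3"
    if "n > 0" and n: "norm a \<le> n" "norm b \<le> n" "2 * n < e" for a b n
  proof -
    have "x + h \<in> ball x0 d" if "norm h < e" for h
      using that by (intro subsetD[OF e(2)]) (simp add: dist_norm)
    then have ball: "x + a \<in> ball x0 d" "x + b \<in> ball x0 d" "x + a + b \<in> ball x0 d"
      using n norm_triangle_ineq[of a b] \<open>n > 0\<close> by (simp_all add: add.assoc)
    have pb: "K * norm b ^ k \<le> K * n ^ k" "K * norm a ^ k \<le> K * n ^ k" for k
      using n K_nonneg by (simp_all add: mult_left_mono power_mono)
    have 1: "norm (f (x + a + b) - f (x + a) - f1 (x + a) b - (1/2) *\<^sub>R f2 (x + a) b b) \<le> K * n ^ 3"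
      using taylor2[OF ball(1,3)] pb(1)[of 3] by simp
    have 2: "norm (f (x + b) - f x - f1 x b - (1/2) *\<^sub>R f2 x b b) \<le> K * n ^ 3"
      using taylor2[OF x ball(2)] pb(1)[of 3] by simp
    have "norm (f1 (x + a) - f1 x - f2 x a) \<le> K * n ^ 2"
      using rem1[OF x ball(1)] pb(2)[of 2] by simp
    then have "norm (f1 (x + a) - f1 x - f2 x a) * norm b \<le> (K * n ^ 2) * n"
      using n K_nonneg by (intro mult_mono) auto
    then have 3: "norm ((f1 (x + a) - f1 x - f2 x a) b) \<le> K * n ^ 3"
      using norm_blinfun[of "f1 (x + a) - f1 x - f2 x a" b]
      by (simp add: power3_eq_cube power2_eq_square mult.assoc)
    have "norm (f2 (x + a) - f2 x) \<le> K * n"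
      using lip2[OF x ball(1)] pb(2)[of 1] by simp
    then have "norm (f2 (x + a) - f2 x) * norm b * norm b \<le> (K * n) * n * n"
      using n K_nonneg \<open>n > 0\<close> by (intro mult_mono) auto
    moreover have "norm ((f2 (x + a) - f2 x) b b) \<le> norm (f2 (x + a) - f2 x) * norm b * norm b"
      by (meson mult_right_mono norm_blinfun norm_ge_zero order_trans)
    ultimately have "norm ((f2 (x + a) - f2 x) b b) \<le> K * n ^ 3"
      by (simp add: power3_eq_cube mult.assoc)
    then have 4: "norm ((1/2) *\<^sub>R (f2 (x + a) - f2 x) b b) \<le> K * n ^ 3"
      by (rule order_trans[rotated]) simp
    have eq: "f (x + (a + b)) - f (x + a) - f (x + b) + f x - f2 x a b =
        (f (x + a + b) - f (x + a) - f1 (x + a) b - (1/2) *\<^sub>R f2 (x + a) b b)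
        - (f (x + b) - f x - f1 x b - (1/2) *\<^sub>R f2 x b b)
        + (f1 (x + a) - f1 x - f2 x a) b + (1/2) *\<^sub>R (f2 (x + a) - f2 x) b b"
      by (simp add: blinfun.bilinear_simps algebra_simps)
    have "norm (p - q + r + s) \<le> norm p + norm q + norm r + norm s" for p q r s :: 'b
      using norm_triangle_ineq[of "p - q + r" s] norm_triangle_ineq[of "p - q" r]
        norm_triangle_ineq4[of p q] by linarith
    note this[of "f (x + a + b) - f (x + a) - f1 (x + a) b - (1/2) *\<^sub>R f2 (x + a) b b"
        "f (x + b) - f x - f1 x b - (1/2) *\<^sub>R f2 x b b"
        "(f1 (x + a) - f1 x - f2 x a) b" "(1/2) *\<^sub>R (f2 (x + a) - f2 x) b b"]
    then show ?thesis unfolding eq using 1 2 3 4 by linarith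
  qed
  have "norm (f2 x u v - f2 x v u) \<le> (8 * K * m ^ 3) * t" if t: "0 < t" "t * (2 * m) < e" for t
  proof -
    have le: "norm (t *\<^sub>R u) \<le> t * m" "norm (t *\<^sub>R v) \<le> t * m"
      using t m by (auto simp: mult_left_mono)
    have pos: "t * m > 0" "2 * (t * m) < e" using t m by (auto simp: mult_ac)
    have "norm (f2 x (t *\<^sub>R u) (t *\<^sub>R v) - f2 x (t *\<^sub>R v) (t *\<^sub>R u)) \<le> 8 * K * (t * m) ^ 3"
    proof -
      have "norm (q - q') \<le> norm (p - a - b + c - q) + norm (p - b - a + c - q')"
        for p q q' a b c :: 'b
        using norm_triangle_ineq4[of "p - b - a + c - q'" "p - a - b + c - q"]
        by (simp add: algebra_simps)
      from this[of "f2 x (t *\<^sub>R u) (t *\<^sub>R v)" "f2 x (t *\<^sub>R v) (t *\<^sub>R u)"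
          "f (x + (t *\<^sub>R u + t *\<^sub>R v))" "f (x + t *\<^sub>R u)" "f (x + t *\<^sub>R v)" "f x"]
      show ?thesis
        using *[OF pos(1) le pos(2)]
          *[OF pos(1) le(2,1) pos(2), unfolded add.commute[of "t *\<^sub>R v" "t *\<^sub>R u"]]
        by linarith
    qed
    moreover have "f2 x (t *\<^sub>R u) (t *\<^sub>R v) - f2 x (t *\<^sub>R v) (t *\<^sub>R u) = t\<^sup>2 *\<^sub>R (f2 x u v - f2 x v u)"
      by (simp add: blinfun.bilinear_simps power2_eq_square algebra_simps)
    ultimately have "t\<^sup>2 * norm (f2 x u v - f2 x v u) \<le> t\<^sup>2 * ((8 * K * m ^ 3) * t)"
      by (simp add: power_mult_distrib power2_eq_square power3_eq_cube mult_ac)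
    then show ?thesis using t by simp
  qed
  then have ev: "\<forall>\<^sub>F t in at_right 0. norm (f2 x u v - f2 x v u) \<le> (8 * K * m ^ 3) * t"
    unfolding eventually_at_right_field using e m
    by (intro exI[of _ "e / (2 * m)"]) (auto simp: field_simps)
  have lim: "((\<lambda>t. (8 * K * m ^ 3) * t) \<longlongrightarrow> (8 * K * m ^ 3) * 0) (at_right 0)"
    by (intro tendsto_intros)
  have "norm (f2 x u v - f2 x v u) \<le> (8 * K * m ^ 3) * 0"
    by (rule tendsto_lowerbound[OF lim ev]) simp
  then show ?thesis by simp
qed

end

lemma isCont_norm_bound_near:
  fixes g :: "'a::t2_space \<Rightarrow> 'b::real_normed_vector"
  assumes "isCont g x"
  shows "\<forall>\<^sub>F y in nhds x. norm (g y) < norm (g x) + 1"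
proof -
  have "((\<lambda>y. norm (g y)) \<longlongrightarrow> norm (g x)) (nhds x)"
    using assms by (intro tendsto_norm) (simp add: isCont_def tendsto_at_iff_tendsto_nhds)
  then show ?thesis by (rule order_tendstoD) simp
qed

text \<open>The third derivative is used only here: being continuous, it is bounded near \<open>x0\<close>, which makes
  the second derivative Lipschitz.\<close>

lemma C3_on_taylor_ball:
  fixes f :: "'a::real_normed_vector \<Rightarrow> 'b::real_normed_vector"
  assumes "C3_on U f" "x0 \<in> U"
  obtains f1 f2 d K where "taylor_ball f f1 f2 x0 d K" "ball x0 d \<subseteq> U"
proof -
  obtain f1 f2 f3 where U: "open U"
    and 1: "\<And>x. x \<in> U \<Longrightarrow> (f has_derivative blinfun_apply (f1 x)) (at x)"
    and 2: "\<And>x. x \<in> U \<Longrightarrow> (f1 has_derivative blinfun_apply (f2 x)) (at x)"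
    and 3: "\<And>x. x \<in> U \<Longrightarrow> (f2 has_derivative blinfun_apply (f3 x)) (at x)"
    and cont: "continuous_on U f3"
    using assms(1) unfolding C3_on_def by blast
  have "isCont f3 x0" using cont U assms(2) by (simp add: continuous_on_eq_continuous_at)
  moreover have "isCont f1 x0" "isCont f2 x0"
    using 2 3 assms(2) has_derivative_continuous by blast+
  ultimately have "\<forall>\<^sub>F x in nhds x0. x \<in> U \<and> norm (f1 x) < norm (f1 x0) + 1
      \<and> norm (f2 x) < norm (f2 x0) + 1 \<and> norm (f3 x) < norm (f3 x0) + 1"
    using eventually_nhds_in_open[OF U assms(2)]
    by (intro eventually_conj isCont_norm_bound_near)
  then obtain d where d: "d > 0" "\<And>x. x \<in> ball x0 d \<Longrightarrow> x \<in> U \<and> norm (f1 x) < norm (f1 x0) + 1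
      \<and> norm (f2 x) < norm (f2 x0) + 1 \<and> norm (f3 x) < norm (f3 x0) + 1"
    unfolding eventually_nhds_metric by (auto simp: dist_commute)
  define K where "K = norm (f1 x0) + norm (f2 x0) + norm (f3 x0) + 1"
  have "taylor_ball f f1 f2 x0 d K"
  proof
    show "norm (f1 x) \<le> K" "norm (f2 x) \<le> K" if "x \<in> ball x0 d" for x
      using d(2)[OF that] norm_ge_zero[of "f1 x0"] norm_ge_zero[of "f2 x0"] norm_ge_zero[of "f3 x0"]
      unfolding K_def by linarith+
    show "norm (f2 y - f2 x) \<le> K * norm (y - x)" if "x \<in> ball x0 d" "y \<in> ball x0 d" for x y
    proof (rule differentiable_bound[OF convex_ball _ _ that(2,1)])
      show "(f2 has_derivative blinfun_apply (f3 z)) (at z within ball x0 d)" if "z \<in> ball x0 d" for z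
        using 3 d(2)[OF that] has_derivative_at_withinI by blast
      show "onorm (blinfun_apply (f3 z)) \<le> K" if "z \<in> ball x0 d" for z
        using d(2)[OF that] norm_ge_zero[of "f1 x0"] norm_ge_zero[of "f2 x0"]
        unfolding K_def norm_blinfun.rep_eq[symmetric] by linarith
    qed
  qed (use d 1 2 in \<open>auto simp: K_def\<close>)
  moreover have "ball x0 d \<subseteq> U" using d by blast
  ultimately show ?thesis using that by blast
qed

section \<open>Derivatives along a subspace\<close>

text \<open>A derivative within a subspace is not unique as a linear map, but it is unique on the subspace:
  there it can be computed along lines.  The derivatives of the retraction in the fibre direction
  are of this kind.\<close>

lemma has_derivative_within_subspace_unique:
  fixes f :: "'a::real_normed_vector \<Rightarrow> 'b::real_normed_vector"
  assumes S: "subspace S" and xu: "x \<in> S" "u \<in> S"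
    and f': "(f has_derivative f') (at x within S)" and f'': "(f has_derivative f'') (at x within S)"
  shows "f' u = f'' u"
proof -
  let ?p = "\<lambda>t::real. x + t *\<^sub>R u"
  have p: "(?p has_derivative (\<lambda>h. h *\<^sub>R u)) (at 0)"
    by (auto intro!: derivative_eq_intros)
  have sub: "range ?p \<subseteq> S"
    using S xu by (auto intro: subspace_add subspace_scale)
  have "((\<lambda>t. f (?p t)) has_derivative (\<lambda>h. g (h *\<^sub>R u))) (at 0)"
    if "(f has_derivative g) (at x within S)" for g
  proof (rule has_derivative_in_compose[OF p])
    show "(f has_derivative g) (at (?p 0) within range ?p)"
      using has_derivative_subset[OF that sub] by simp
  qed
  from has_derivative_unique[OF this[OF f'] this[OF f'']]
  have "(\<lambda>h::real. f' (h *\<^sub>R u)) = (\<lambda>h. f'' (h *\<^sub>R u))" .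
  from fun_cong[OF this, of 1] show ?thesis by simp
qed

lemma frechet_derivative_within_subspace:
  fixes f :: "'a::real_normed_vector \<Rightarrow> 'b::real_normed_vector"
  assumes "subspace S" "x \<in> S" "u \<in> S" "(f has_derivative f') (at x within S)"
  shows "frechet_derivative f (at x within S) u = f' u"
  using assms has_derivative_within_subspace_unique frechet_derivative_works differentiable_def
  by metis

lemma second_derivative_eq:
  fixes f :: "'a::real_normed_vector \<Rightarrow> 'b::real_normed_vector"
  assumes S: "subspace S" and U: "open U" and x: "x \<in> S" "x \<in> U"
    and eq: "\<And>y. y \<in> S \<Longrightarrow> y \<in> U \<Longrightarrow> f y = h y"
    and h1: "\<And>y. y \<in> U \<Longrightarrow> (h has_derivative h1 y) (at y)"
    and h2: "((\<lambda>y. h1 y u) has_derivative h2) (at x)"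
    and uv: "u \<in> S" "v \<in> S"
  shows "second_derivative f S x u v = h2 v"
proof -
  have near: "\<exists>e>0. \<forall>z. dist z y < e \<longrightarrow> z \<in> U" if "y \<in> U" for y
    using U that by (simp add: open_dist)
  have first: "frechet_derivative f (at y within S) u = h1 y u" if y: "y \<in> S" "y \<in> U" for y
  proof -
    obtain e where e: "e > 0" "\<And>z. dist z y < e \<Longrightarrow> z \<in> U" using near[OF y(2)] by blast
    have "(f has_derivative h1 y) (at y within S)"
      by (rule has_derivative_transform_within[OF has_derivative_at_withinI[OF h1[OF y(2)]] e(1) y(1)])
        (simp add: e(2) eq)
    then show ?thesis using frechet_derivative_within_subspace S y(1) uv(1) by blast
  qed
  obtain e where e: "e > 0" "\<And>z. dist z x < e \<Longrightarrow> z \<in> U" using near[OF x(2)] by blast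
  have "((\<lambda>y. frechet_derivative f (at y within S) u) has_derivative h2) (at x within S)"
    by (rule has_derivative_transform_within[OF has_derivative_at_withinI[OF h2] e(1) x(1)])
      (simp add: first e(2))
  then show ?thesis
    unfolding second_derivative_def using frechet_derivative_within_subspace S x(1) uv(2) by blast
qed

section \<open>Linear algebra\<close>

lemma bounded_below_of_trivial_common_kernel:
  fixes A :: "'a::euclidean_space \<Rightarrow>\<^sub>L 'b::real_normed_vector"
    and D :: "'a \<Rightarrow>\<^sub>L 'c::real_normed_vector"
  assumes "\<And>v. A v = 0 \<Longrightarrow> D v = 0 \<Longrightarrow> v = 0"
  obtains c where "c > 0" "\<And>v. norm v \<le> c * (norm (A v) + norm (D v))"
proof -
  let ?g = "\<lambda>v. norm (A v) + norm (D v)"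
  have "sphere (0::'a) 1 \<noteq> {}" by simp
  moreover have "continuous_on (sphere 0 1) ?g" by (intro continuous_intros)
  ultimately obtain v0 where v0: "norm v0 = 1" "\<And>v. norm v = 1 \<Longrightarrow> ?g v0 \<le> ?g v"
    using continuous_attains_inf[of "sphere (0::'a) 1" ?g] by auto
  have "?g v0 \<noteq> 0" using assms[of v0] v0(1) by (auto simp: add_nonneg_eq_0_iff)
  then have pos: "?g v0 > 0" by (simp add: less_le)
  show ?thesis
  proof
    show "1 / ?g v0 > 0" using pos by simp
    show "norm v \<le> 1 / ?g v0 * ?g v" for v
    proof (cases "v = 0")
      case False
      have "?g v0 \<le> ?g (v /\<^sub>R norm v)" using v0(2)[of "v /\<^sub>R norm v"] False by simp
      also have "\<dots> = ?g v / norm v"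
        by (simp add: blinfun.scaleR_right divide_inverse_commute distrib_left)
      finally show ?thesis using pos False by (simp add: field_simps)
    qed simp
  qed
qed

text \<open>Rank-nullity as an inequality, for a codomain that has a finite spanning set without being a
  Euclidean space: \<open>D\<close> is injective on the orthogonal complement of its kernel.\<close>

lemma DIM_le_dim_kernel_plus_dim:
  fixes D :: "'a::euclidean_space \<Rightarrow> 'l::real_vector"
  assumes fin: "finite_dimensional TYPE('l)" and D: "linear D"
  shows "DIM('a) \<le> dim {v. D v = 0} + dim (UNIV :: 'l set)"
proof -
  let ?K = "{v. D v = 0}"
  have K: "subspace ?K" using D by (rule linear_subspace_kernel)
  define W where "W = {y \<in> UNIV. \<forall>x\<in>?K. orthogonal x y}"
  have dimW: "dim W + dim ?K = DIM('a)"
    unfolding W_def using dim_subspace_orthogonal_to_vectors[OF K subspace_UNIV] by simp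
  have W: "subspace W"
    unfolding W_def using subspace_orthogonal_to_vectors[of ?K] by simp
  have inj: "inj_on D W"
  proof (rule linear_inj_on_iff_eq_0[OF D W, THEN iffD2], safe)
    fix x assume x: "x \<in> W" "D x = 0"
    then have "orthogonal x x" by (auto simp: W_def)
    then show "x = 0" by (simp add: orthogonal_self)
  qed
  obtain B where B: "B \<subseteq> W" "independent B" "W \<subseteq> span B" "card B = dim W"
    using basis_exists by blast
  have "span B \<subseteq> W" using B(1) W by (simp add: span_minimal)
  then have injB: "inj_on D (span B)" using inj inj_on_subset by blast
  have ind: "independent (D ` B)" using linear_independent_injective_image[OF D B(2) injB] .
  obtain B0 :: "'l set" where B0: "finite B0" "span B0 = UNIV"
    using fin unfolding finite_dimensional_def by blast
  obtain B1 where B1: "B1 \<subseteq> (UNIV :: 'l set)" "independent B1" "UNIV \<subseteq> span B1" "card B1 = dim (UNIV :: 'l set)"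
    using basis_exists by blast
  have "finite B1" using independent_span_bound[OF B0(1) B1(2)] B0(2) by simp
  then have "card (D ` B) \<le> card B1"
    using independent_span_bound[OF _ ind] B1(3) by blast
  moreover have "card (D ` B) = card B"
    using injB span_superset by (meson card_image inj_on_subset)
  ultimately show ?thesis using dimW B B1 by simp
qed

lemma linear_onto_of_dim:
  fixes A :: "'a::euclidean_space \<Rightarrow> 'b::euclidean_space"
  assumes "linear A" "subspace S" "subspace R" "A ` S \<subseteq> R" "dim R \<le> dim S"
    and "\<And>v. v \<in> S \<Longrightarrow> A v = 0 \<Longrightarrow> v = 0"
  shows "bij_betw A S R"
proof -
  have inj: "inj_on A S"
    using assms by (simp add: linear_inj_on_iff_eq_0)
  have "dim (A ` S) = dim S"
    using dim_image_eq[OF assms(1), of S] inj span_eq_iff[THEN iffD2, OF assms(2)] by simp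
  then have "A ` S = R"
    using assms by (intro subspace_dim_equal linear_subspace_image) auto
  then show ?thesis using inj by (simp add: bij_betw_def)
qed

section \<open>Iterations whose step is locally of third order\<close>

text \<open>A step of third order at least halves the distance once that distance is small, so an iteration
  never leaves the neighbourhood in which the step is well defined.\<close>

lemma locally_cubically_convergentI:
  fixes C :: "'e::euclidean_space \<Rightarrow> 'l::real_inner"
  assumes "\<forall>\<^sub>F X in nhds Xs. X \<in> constraint_set C \<longrightarrow>
    (\<exists>!\<xi>. upd X \<xi>) \<and> (\<forall>\<xi>. upd X \<xi> \<longrightarrow> (X, \<xi>) \<in> T \<and> r (X, \<xi>) \<in> constraint_set C
      \<and> norm (r (X, \<xi>) - Xs) \<le> c * norm (X - Xs) ^ 3)"
  shows "locally_cubically_convergent C T r upd Xs"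
proof -
  let ?M = "constraint_set C"
  obtain d where d: "d > 0"
    and ex1: "\<And>X. X \<in> ?M \<Longrightarrow> norm (X - Xs) < d \<Longrightarrow> \<exists>!\<xi>. upd X \<xi>"
    and step: "\<And>X \<xi>. X \<in> ?M \<Longrightarrow> norm (X - Xs) < d \<Longrightarrow> upd X \<xi> \<Longrightarrow>
      (X, \<xi>) \<in> T \<and> r (X, \<xi>) \<in> ?M \<and> norm (r (X, \<xi>) - Xs) \<le> c * norm (X - Xs) ^ 3"
    using assms unfolding eventually_nhds_metric dist_norm by blast
  \<comment> \<open>The radius makes \<open>c * t ^ 3 \<le> t / 2\<close> for \<open>0 \<le> t < \<delta>\<close>.\<close>
  define \<delta> where "\<delta> = min d (min 1 (1 / (2 * \<bar>c\<bar> + 1)))"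
  have \<delta>: "\<delta> > 0" "\<delta> \<le> d" "\<delta> \<le> 1" "\<delta> \<le> 1 / (2 * \<bar>c\<bar> + 1)"
  proof -
    show "\<delta> \<le> 1" unfolding \<delta>_def by (meson min.cobounded1 min.cobounded2 order_trans)
  qed (use d in \<open>auto simp: \<delta>_def\<close>)
  have half: "c * t ^ 3 \<le> t / 2" if t: "0 \<le> t" "t < \<delta>" for t
  proof -
    have "c * t\<^sup>2 \<le> \<bar>c\<bar> * t"
    proof -
      have "t\<^sup>2 \<le> t * 1" unfolding power2_eq_square using t \<delta> by (intro mult_left_mono) auto
      then have "\<bar>c\<bar> * t\<^sup>2 \<le> \<bar>c\<bar> * t" by (simp add: mult_left_mono)
      moreover have "c * t\<^sup>2 \<le> \<bar>c\<bar> * t\<^sup>2" by (simp add: mult_right_mono)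
      ultimately show ?thesis by simp
    qed
    also have "\<bar>c\<bar> * t \<le> \<bar>c\<bar> * (1 / (2 * \<bar>c\<bar> + 1))"
      using t \<delta> by (intro mult_left_mono) auto
    also have "\<dots> \<le> 1 / 2" by (simp add: field_simps)
    finally have "t * (c * t\<^sup>2) \<le> t * (1 / 2)" using t by (intro mult_left_mono) auto
    then show ?thesis by (simp add: power3_eq_cube power2_eq_square mult_ac)
  qed
  have next_near: "(X, \<xi>) \<in> T \<and> r (X, \<xi>) \<in> ?M \<and> norm (r (X, \<xi>) - Xs) \<le> norm (X - Xs) / 2
      \<and> norm (r (X, \<xi>) - Xs) \<le> c * norm (X - Xs) ^ 3"
    if "X \<in> ?M" "norm (X - Xs) < \<delta>" "upd X \<xi>" for X \<xi>
    using step[OF that(1) _ that(3)] half[OF norm_ge_zero that(2)] that(2) \<delta>(2) by fastforce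
  have stays: "r (X, \<xi>) \<in> ?M \<and> norm (r (X, \<xi>) - Xs) < \<delta>"
    if "X \<in> ?M" "norm (X - Xs) < \<delta>" "upd X \<xi>" for X \<xi>
    using next_near[OF that] that(2) norm_ge_zero[of "X - Xs"] by linarith
  have solvable: "\<exists>!\<xi>. upd X \<xi>" if "X \<in> ?M \<and> norm (X - Xs) < \<delta>" for X
    using ex1[of X] that \<delta>(2) by linarith
  show ?thesis
    unfolding locally_cubically_convergent_def
  proof (intro exI[of _ \<delta>] conjI ballI impI allI \<delta>(1))
    fix X0 assume X0: "X0 \<in> ?M" "dist X0 Xs < \<delta>"
    define X where "X = rec_nat X0 (\<lambda>_ Y. r (Y, THE \<xi>. upd Y \<xi>))"
    define \<xi> where "\<xi> i = (THE \<xi>. upd (X i) \<xi>)" for i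
    have X_0: "X 0 = X0" and X_Suc: "X (Suc i) = r (X i, \<xi> i)" for i
      by (simp_all add: X_def \<xi>_def)
    have "X i \<in> ?M \<and> norm (X i - Xs) < \<delta>" for i
    proof (induction i)
      case 0
      show ?case using X0 by (simp add: X_0 dist_norm)
    next
      case (Suc i)
      then show ?case
        using stays[OF _ _ theI'[OF solvable[OF Suc]]] by (simp only: X_Suc \<xi>_def)
    qed
    then have "upd (X i) (\<xi> i)" for i
      unfolding \<xi>_def using theI'[OF solvable] by blast
    then have "X 0 = X0 \<and> is_iteration r upd X \<xi>"
      by (simp add: is_iteration_def X_0 X_Suc)
    then show "\<exists>X \<xi>. X 0 = X0 \<and> is_iteration r upd X \<xi>" by blast
  next
    fix X0 X \<xi> assume X0: "X0 \<in> ?M" "dist X0 Xs < \<delta>" and it: "X 0 = X0 \<and> is_iteration r upd X \<xi>"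
    have upd: "upd (X i) (\<xi> i)" and X_Suc: "X (Suc i) = r (X i, \<xi> i)" for i
      using it by (simp_all add: is_iteration_def)
    have near: "X i \<in> ?M \<and> norm (X i - Xs) < \<delta>" for i
    proof (induction i)
      case 0
      show ?case using X0 it by (simp add: dist_norm)
    next
      case (Suc i)
      then show ?case using stays[OF _ _ upd[of i]] by (simp only: X_Suc)
    qed
    note nx = next_near[OF near[THEN conjunct1] near[THEN conjunct2] upd, folded X_Suc]
    show "(X i, \<xi> i) \<in> T" for i using nx by blast
    show "\<exists>!\<zeta>. upd (X i) \<zeta>" for i using solvable[OF near] .
    have decay: "norm (X i - Xs) \<le> \<delta> * (1/2) ^ i" for i
    proof (induction i)
      case 0
      show ?case using near[of 0] by simp
    next
      case (Suc i)
      have "norm (X (Suc i) - Xs) \<le> norm (X i - Xs) / 2" using nx by blast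
      with Suc show ?case by simp
    qed
    have "(\<lambda>i. \<delta> * (1/2) ^ i) \<longlonglongrightarrow> 0"
      by (intro tendsto_mult_right_zero LIMSEQ_power_zero) simp
    then have "(\<lambda>i. X i - Xs) \<longlonglongrightarrow> 0"
      by (rule Lim_null_comparison[OF always_eventually[OF allI[OF decay]]])
    then have "X \<longlonglongrightarrow> Xs" by (simp add: LIM_zero_iff)
    moreover have "\<forall>\<^sub>F i in sequentially. norm (X (Suc i) - Xs) \<le> c * norm (X i - Xs) ^ 3"
      using nx by (intro always_eventually allI) blast
    ultimately show "converges_cubically X Xs"
      unfolding converges_cubically_def by blast
  qed
qed

section \<open>Calm families of operators and bilinear maps\<close>

text \<open>Calmness is Lipschitz continuity with one of the two points fixed.  Comparing each iterate with
  \<open>Xs\<close> needs no more, and it is preserved by all the operations that build the quadratic forms.\<close>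

definition calm_at :: "('a::real_normed_vector \<Rightarrow> 'b::real_normed_vector) \<Rightarrow> 'a \<Rightarrow> bool" where
  "calm_at f x0 \<longleftrightarrow> (\<exists>K\<ge>0. \<forall>\<^sub>F x in nhds x0. norm (f x - f x0) \<le> K * norm (x - x0))"

text \<open>Plain bilinear functions instead of operators, because the forms are assembled from several
  operators and only their values are ever compared.\<close>

definition calm_bilinear :: "'a \<Rightarrow> ('a::real_normed_vector \<Rightarrow> 'b::real_normed_vector \<Rightarrow> 'b \<Rightarrow> 'c::real_normed_vector) \<Rightarrow> bool" where
  "calm_bilinear x0 B \<longleftrightarrow> (\<exists>K\<ge>0. \<forall>\<^sub>F x in nhds x0. bilinear (B x)
     \<and> (\<forall>u v. norm (B x u v) \<le> K * norm u * norm v)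
     \<and> (\<forall>u v. norm (B x u v - B x0 u v) \<le> K * norm (x - x0) * norm u * norm v))"

lemma (in taylor_ball) calm: "calm_at f x0" "calm_at f1 x0" "calm_at f2 x0"
  unfolding calm_at_def
  by (intro exI[of _ K] conjI K_nonneg eventually_mono[OF near] lip0 lip1 lip2 center; assumption)+

lemma calm_atE:
  assumes "calm_at f x0"
  obtains K where "0 \<le> K" "norm (f x0) \<le> K"
    "\<forall>\<^sub>F x in nhds x0. norm (f x) \<le> K \<and> norm (f x - f x0) \<le> K * norm (x - x0)"
proof -
  obtain k where k: "0 \<le> k" "\<forall>\<^sub>F x in nhds x0. norm (f x - f x0) \<le> k * norm (x - x0)"
    using assms unfolding calm_at_def by blast
  have "\<forall>\<^sub>F x in nhds x0. norm (f x) \<le> k + norm (f x0) + 1 \<and>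
      norm (f x - f x0) \<le> (k + norm (f x0) + 1) * norm (x - x0)"
    using k(2) eventually_small[of 1 k x0, simplified]
  proof eventually_elim
    case (elim x)
    have "norm (f x) \<le> norm (f x0) + norm (f x - f x0)" using norm_triangle_sub[of "f x"] by simp
    moreover have "k * norm (x - x0) \<le> (k + norm (f x0) + 1) * norm (x - x0)"
      by (intro mult_right_mono) auto
    ultimately show ?case using elim k(1) by linarith
  qed
  then show ?thesis using that[of "k + norm (f x0) + 1"] k(1) by simp
qed

lemma calm_at_const: "calm_at (\<lambda>x. c) x0"
  by (auto simp: calm_at_def)

lemma calm_at_add:
  assumes "calm_at f x0" "calm_at g x0"
  shows "calm_at (\<lambda>x. f x + g x) x0"
proof -
  obtain k where k: "0 \<le> k" "\<forall>\<^sub>F x in nhds x0. norm (f x - f x0) \<le> k * norm (x - x0)"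
    using assms(1) unfolding calm_at_def by blast
  obtain l where l: "0 \<le> l" "\<forall>\<^sub>F x in nhds x0. norm (g x - g x0) \<le> l * norm (x - x0)"
    using assms(2) unfolding calm_at_def by blast
  have "\<forall>\<^sub>F x in nhds x0. norm (f x + g x - (f x0 + g x0)) \<le> (k + l) * norm (x - x0)"
    using k(2) l(2)
  proof eventually_elim
    case (elim x)
    have "norm (f x + g x - (f x0 + g x0)) \<le> norm (f x - f x0) + norm (g x - g x0)"
      by (rule norm_diff_triangle_ineq)
    with elim show ?case by (simp add: distrib_right)
  qed
  then show ?thesis unfolding calm_at_def using k(1) l(1) by (intro exI[of _ "k + l"]) simp
qed

lemma calm_at_bounded_linear:
  assumes "bounded_linear h" "calm_at f x0"
  shows "calm_at (\<lambda>x. h (f x)) x0"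
proof -
  interpret h: bounded_linear h by fact
  obtain b where b: "0 \<le> b" "\<And>x. norm (h x) \<le> norm x * b" using h.nonneg_bounded by blast
  obtain k where k: "0 \<le> k" "\<forall>\<^sub>F x in nhds x0. norm (f x - f x0) \<le> k * norm (x - x0)"
    using assms(2) unfolding calm_at_def by blast
  from k(2) have "\<forall>\<^sub>F x in nhds x0. norm (h (f x) - h (f x0)) \<le> k * b * norm (x - x0)"
  proof eventually_elim
    case (elim x)
    have "norm (h (f x) - h (f x0)) \<le> norm (f x - f x0) * b"
      using b(2)[of "f x - f x0"] by (simp add: h.diff)
    also have "\<dots> \<le> k * norm (x - x0) * b" using elim b(1) by (rule mult_right_mono)
    finally show ?case by (simp add: mult_ac)
  qed
  then show ?thesis unfolding calm_at_def using k(1) b(1) by (intro exI[of _ "k * b"]) simp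
qed

lemma (in taylor_ball) calm_compose:
  assumes h: "calm_at h y0" "h y0 = x0"
  shows "calm_at (\<lambda>y. f1 (h y)) y0" "calm_at (\<lambda>y. f2 (h y)) y0"
    and "\<forall>\<^sub>F y in nhds y0. h y \<in> ball x0 d"
proof -
  obtain k where k: "0 \<le> k" "\<forall>\<^sub>F y in nhds y0. norm (h y - h y0) \<le> k * norm (y - y0)"
    using assms(1) unfolding calm_at_def by blast
  show ball: "\<forall>\<^sub>F y in nhds y0. h y \<in> ball x0 d"
    using k(2) eventually_small[OF d_pos, of k y0]
    by eventually_elim (simp add: h(2) dist_norm norm_minus_commute)
  have "\<forall>\<^sub>F y in nhds y0. norm (f1 (h y) - f1 (h y0)) \<le> K * k * norm (y - y0)
      \<and> norm (f2 (h y) - f2 (h y0)) \<le> K * k * norm (y - y0)"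
    using k(2) ball
  proof eventually_elim
    case (elim y)
    have "K * norm (h y - h y0) \<le> K * (k * norm (y - y0))"
      using elim(1) K_nonneg by (rule mult_left_mono)
    then show ?case
      using lip1[OF center elim(2)] lip2[OF center elim(2)] by (simp add: h(2) mult.assoc)
  qed
  then have "\<forall>\<^sub>F y in nhds y0. norm (f1 (h y) - f1 (h y0)) \<le> K * k * norm (y - y0)"
    and "\<forall>\<^sub>F y in nhds y0. norm (f2 (h y) - f2 (h y0)) \<le> K * k * norm (y - y0)"
    by (simp_all add: eventually_conj_iff)
  moreover have "0 \<le> K * k" using K_nonneg k(1) by simp
  ultimately show "calm_at (\<lambda>y. f1 (h y)) y0" "calm_at (\<lambda>y. f2 (h y)) y0"
    unfolding calm_at_def by blast+
qed

lemma norm_blinfun2_le: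
  assumes "norm A \<le> a" "norm u \<le> b" "norm v \<le> c"
  shows "norm (blinfun_apply (blinfun_apply A u) v) \<le> a * b * c"
  by (intro norm_blinfun_le assms)

text \<open>Every second-order term in this theory is a second derivative evaluated on arguments that depend
  linearly on the tangent vector, with a coefficient \<open>P x\<close> that may vary with the base point.\<close>

lemma calm_bilinear_quadratic:
  fixes \<Phi> :: "'a::real_normed_vector \<Rightarrow> 'v::real_normed_vector \<Rightarrow>\<^sub>L 'v \<Rightarrow>\<^sub>L 'w::real_normed_vector"
    and P :: "'a \<Rightarrow> 'b::real_normed_vector \<Rightarrow>\<^sub>L 'v"
  assumes "calm_at \<Phi> x0" "calm_at P x0"
  shows "calm_bilinear x0 (\<lambda>x u v. \<Phi> x (P x u) (P x v))"
proof -
  obtain k where k: "0 \<le> k" "norm (\<Phi> x0) \<le> k"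
      "\<forall>\<^sub>F x in nhds x0. norm (\<Phi> x) \<le> k \<and> norm (\<Phi> x - \<Phi> x0) \<le> k * norm (x - x0)"
    using calm_atE[OF assms(1)] by blast
  obtain p where p: "0 \<le> p" "norm (P x0) \<le> p"
      "\<forall>\<^sub>F x in nhds x0. norm (P x) \<le> p \<and> norm (P x - P x0) \<le> p * norm (x - x0)"
    using calm_atE[OF assms(2)] by blast
  let ?K = "3 * (k * p * p)"
  have kp: "0 \<le> k * p * p" using k(1) p(1) by simp
  have "\<forall>\<^sub>F x in nhds x0. bilinear (\<lambda>u v. \<Phi> x (P x u) (P x v))
     \<and> (\<forall>u v. norm (\<Phi> x (P x u) (P x v)) \<le> ?K * norm u * norm v)
     \<and> (\<forall>u v. norm (\<Phi> x (P x u) (P x v) - \<Phi> x0 (P x0 u) (P x0 v)) \<le> ?K * norm (x - x0) * norm u * norm v)"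
    using k(3) p(3)
  proof eventually_elim
    case (elim x)
    let ?e = "norm (x - x0)"
    have "bilinear (\<lambda>u v. \<Phi> x (P x u) (P x v))"
      unfolding bilinear_def linear_iff by (simp add: blinfun.bilinear_simps)
    moreover have "norm (\<Phi> x (P x u) (P x v)) \<le> ?K * norm u * norm v" for u v
    proof -
      have "norm (\<Phi> x (P x u) (P x v)) \<le> k * (p * norm u) * (p * norm v)"
        using elim by (intro norm_blinfun_le order_refl) auto
      also have "\<dots> = (k * p * p) * (norm u * norm v)" by (simp add: mult_ac)
      also have "\<dots> \<le> ?K * (norm u * norm v)" using kp by (intro mult_right_mono) (linarith, simp)
      finally show ?thesis by (simp add: mult.assoc)
    qed
    moreover have "norm (\<Phi> x (P x u) (P x v) - \<Phi> x0 (P x0 u) (P x0 v)) \<le> ?K * ?e * norm u * norm v" for u v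
    proof -
      have "\<Phi> x (P x u) (P x v) - \<Phi> x0 (P x0 u) (P x0 v) = (\<Phi> x - \<Phi> x0) (P x u) (P x v)
          + \<Phi> x0 ((P x - P x0) u) (P x v) + \<Phi> x0 (P x0 u) ((P x - P x0) v)"
        by (simp add: blinfun.bilinear_simps)
      also have "norm \<dots> \<le> norm ((\<Phi> x - \<Phi> x0) (P x u) (P x v))
          + norm (\<Phi> x0 ((P x - P x0) u) (P x v)) + norm (\<Phi> x0 (P x0 u) ((P x - P x0) v))"
        by (rule order_trans[OF norm_triangle_ineq add_right_mono[OF norm_triangle_ineq]])
      also have "norm ((\<Phi> x - \<Phi> x0) (P x u) (P x v)) \<le> k * ?e * (p * norm u) * (p * norm v)"
        using elim by (intro norm_blinfun_le order_refl) auto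
      also have "norm (\<Phi> x0 ((P x - P x0) u) (P x v)) \<le> k * (p * ?e * norm u) * (p * norm v)"
        using elim k(2) by (intro norm_blinfun_le order_refl) auto
      also have "norm (\<Phi> x0 (P x0 u) ((P x - P x0) v)) \<le> k * (p * norm u) * (p * ?e * norm v)"
        using elim k(2) p(2) by (intro norm_blinfun_le order_refl) auto
      finally show ?thesis by (simp add: mult_ac)
    qed
    ultimately show ?case by blast
  qed
  then show ?thesis unfolding calm_bilinear_def using kp by (intro exI[of _ ?K]) simp
qed

lemma calm_bilinear_apply:
  fixes \<Psi> :: "'a::real_normed_vector \<Rightarrow> 'v::real_normed_vector \<Rightarrow>\<^sub>L 'w::real_normed_vector"
    and B :: "'a \<Rightarrow> 'b::real_normed_vector \<Rightarrow> 'b \<Rightarrow> 'v"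
  assumes "calm_at \<Psi> x0" "calm_bilinear x0 B"
  shows "calm_bilinear x0 (\<lambda>x u v. \<Psi> x (B x u v))"
proof -
  obtain k where k: "0 \<le> k" "norm (\<Psi> x0) \<le> k"
      "\<forall>\<^sub>F x in nhds x0. norm (\<Psi> x) \<le> k \<and> norm (\<Psi> x - \<Psi> x0) \<le> k * norm (x - x0)"
    using calm_atE[OF assms(1)] by blast
  obtain b where b: "0 \<le> b" "\<forall>\<^sub>F x in nhds x0. bilinear (B x)
     \<and> (\<forall>u v. norm (B x u v) \<le> b * norm u * norm v)
     \<and> (\<forall>u v. norm (B x u v - B x0 u v) \<le> b * norm (x - x0) * norm u * norm v)"
    using assms(2) unfolding calm_bilinear_def by blast
  let ?K = "2 * (k * b)"
  have kb: "0 \<le> k * b" using k(1) b(1) by simp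
  have "\<forall>\<^sub>F x in nhds x0. bilinear (\<lambda>u v. \<Psi> x (B x u v))
     \<and> (\<forall>u v. norm (\<Psi> x (B x u v)) \<le> ?K * norm u * norm v)
     \<and> (\<forall>u v. norm (\<Psi> x (B x u v) - \<Psi> x0 (B x0 u v)) \<le> ?K * norm (x - x0) * norm u * norm v)"
    using k(3) b(2)
  proof eventually_elim
    case (elim x)
    let ?e = "norm (x - x0)"
    have "bilinear (\<lambda>u v. \<Psi> x (B x u v))"
      using elim(2) unfolding bilinear_def linear_iff by (simp add: blinfun.bilinear_simps)
    moreover have "norm (\<Psi> x (B x u v)) \<le> ?K * norm u * norm v" for u v
    proof -
      have "norm (\<Psi> x (B x u v)) \<le> k * (b * norm u * norm v)"
        using elim by (intro norm_blinfun_le) auto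
      also have "\<dots> = (k * b) * (norm u * norm v)" by (simp add: mult_ac)
      also have "\<dots> \<le> ?K * (norm u * norm v)" using kb by (intro mult_right_mono) (linarith, simp)
      finally show ?thesis by (simp add: mult.assoc)
    qed
    moreover have "norm (\<Psi> x (B x u v) - \<Psi> x0 (B x0 u v)) \<le> ?K * ?e * norm u * norm v" for u v
    proof -
      have "\<Psi> x (B x u v) - \<Psi> x0 (B x0 u v) = (\<Psi> x - \<Psi> x0) (B x u v) + \<Psi> x0 (B x u v - B x0 u v)"
        by (simp add: blinfun.bilinear_simps)
      also have "norm \<dots> \<le> norm ((\<Psi> x - \<Psi> x0) (B x u v)) + norm (\<Psi> x0 (B x u v - B x0 u v))"
        by (rule norm_triangle_ineq)
      also have "norm ((\<Psi> x - \<Psi> x0) (B x u v)) \<le> k * ?e * (b * norm u * norm v)"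
        using elim by (intro norm_blinfun_le) auto
      also have "norm (\<Psi> x0 (B x u v - B x0 u v)) \<le> k * (b * ?e * norm u * norm v)"
        using elim k(2) by (intro norm_blinfun_le) auto
      finally show ?thesis by (simp add: mult_ac)
    qed
    ultimately show ?case by blast
  qed
  then show ?thesis unfolding calm_bilinear_def using kb by (intro exI[of _ ?K]) simp
qed

lemma calm_bilinear_add:
  assumes "calm_bilinear x0 A" "calm_bilinear x0 B"
  shows "calm_bilinear x0 (\<lambda>x u v. A x u v + B x u v)"
proof -
  obtain a where a: "0 \<le> a" "\<forall>\<^sub>F x in nhds x0. bilinear (A x)
     \<and> (\<forall>u v. norm (A x u v) \<le> a * norm u * norm v)
     \<and> (\<forall>u v. norm (A x u v - A x0 u v) \<le> a * norm (x - x0) * norm u * norm v)"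
    using assms(1) unfolding calm_bilinear_def by blast
  obtain b where b: "0 \<le> b" "\<forall>\<^sub>F x in nhds x0. bilinear (B x)
     \<and> (\<forall>u v. norm (B x u v) \<le> b * norm u * norm v)
     \<and> (\<forall>u v. norm (B x u v - B x0 u v) \<le> b * norm (x - x0) * norm u * norm v)"
    using assms(2) unfolding calm_bilinear_def by blast
  have "\<forall>\<^sub>F x in nhds x0. bilinear (\<lambda>u v. A x u v + B x u v)
     \<and> (\<forall>u v. norm (A x u v + B x u v) \<le> (a + b) * norm u * norm v)
     \<and> (\<forall>u v. norm (A x u v + B x u v - (A x0 u v + B x0 u v)) \<le> (a + b) * norm (x - x0) * norm u * norm v)"
    using a(2) b(2)
  proof eventually_elim
    case (elim x)
    have "bilinear (\<lambda>u v. A x u v + B x u v)"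
      using elim unfolding bilinear_def linear_iff by (simp add: scaleR_add_right)
    moreover have "norm (A x u v + B x u v) \<le> (a + b) * norm u * norm v" for u v
    proof -
      have "norm (A x u v) \<le> a * norm u * norm v" "norm (B x u v) \<le> b * norm u * norm v"
        using elim by blast+
      then show ?thesis using norm_triangle_ineq[of "A x u v" "B x u v"] by (simp add: distrib_right)
    qed
    moreover have "norm (A x u v + B x u v - (A x0 u v + B x0 u v)) \<le> (a + b) * norm (x - x0) * norm u * norm v" for u v
    proof -
      have "norm (A x u v - A x0 u v) \<le> a * norm (x - x0) * norm u * norm v"
        "norm (B x u v - B x0 u v) \<le> b * norm (x - x0) * norm u * norm v"
        using elim by blast+
      then show ?thesis
        using norm_diff_triangle_ineq[of "A x u v" "B x u v" "A x0 u v" "B x0 u v"]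
        by (simp add: distrib_right)
    qed
    ultimately show ?case by blast
  qed
  then show ?thesis unfolding calm_bilinear_def using a(1) b(1) by (intro exI[of _ "a + b"]) simp
qed

text \<open>In the second-order term of the Taylor formula the increment \<open>W\<close> may be replaced by any
  \<open>\<Xi>\<close> that agrees with it to first order.\<close>

lemma (in taylor_ball) taylor2_perturbed:
  assumes xy: "x \<in> ball x0 d" "y \<in> ball x0 d" and k: "0 \<le> k" and s: "0 \<le> s"
    and W: "norm (y - x) \<le> k * s" and \<Xi>: "norm \<Xi> \<le> k * s" and W\<Xi>: "norm (y - x - \<Xi>) \<le> k * s\<^sup>2"
  shows "norm (f y - f x - f1 x (y - x) - (1/2) *\<^sub>R f2 x \<Xi> \<Xi>) \<le> (K * k ^ 3 + K * k\<^sup>2) * s ^ 3"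
proof -
  let ?W = "y - x"
  let ?t = "f y - f x - f1 x ?W - (1/2) *\<^sub>R f2 x ?W ?W"
  let ?c = "(1/2) *\<^sub>R (f2 x (?W - \<Xi>) ?W + f2 x \<Xi> (?W - \<Xi>))"
  have "f2 x (V - \<Xi>) V + f2 x \<Xi> (V - \<Xi>) = f2 x V V - f2 x \<Xi> \<Xi>" for V
    by (simp add: blinfun.diff_left blinfun.diff_right)
  then have eq: "f y - f x - f1 x ?W - (1/2) *\<^sub>R f2 x \<Xi> \<Xi> = ?t + ?c"
    by (simp only: scaleR_diff_right) simp
  have "norm (?t + ?c) \<le> norm ?t + norm ?c"
    by (rule norm_triangle_ineq)
  moreover have "norm ?t \<le> K * (k * s) ^ 3"
    using taylor2[OF xy] mult_left_mono[OF power_mono[OF W norm_ge_zero] K_nonneg] by (rule order_trans)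
  moreover have "norm ?c \<le> K * k\<^sup>2 * s ^ 3"
  proof -
    have "norm (f2 x (?W - \<Xi>) ?W) \<le> K * (k * s\<^sup>2) * (k * s)"
      by (intro norm_blinfun2_le bound2 xy W W\<Xi>)
    moreover have "norm (f2 x \<Xi> (?W - \<Xi>)) \<le> K * (k * s) * (k * s\<^sup>2)"
      by (intro norm_blinfun2_le bound2 xy \<Xi> W\<Xi>)
    moreover have "K * (k * s\<^sup>2) * (k * s) = K * k\<^sup>2 * s ^ 3" "K * (k * s) * (k * s\<^sup>2) = K * k\<^sup>2 * s ^ 3"
      by (simp_all add: power2_eq_square power3_eq_cube)
    ultimately have "norm (f2 x (?W - \<Xi>) ?W + f2 x \<Xi> (?W - \<Xi>)) \<le> 2 * (K * k\<^sup>2 * s ^ 3)"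
      using norm_triangle_ineq[of "f2 x (?W - \<Xi>) ?W" "f2 x \<Xi> (?W - \<Xi>)"] by linarith
    then show ?thesis by simp
  qed
  ultimately have "norm (?t + ?c) \<le> K * (k * s) ^ 3 + K * k\<^sup>2 * s ^ 3" by linarith
  then show ?thesis unfolding eq by (simp add: power_mult_distrib distrib_right mult.assoc)
qed

section \<open>The local geometry at the zero\<close>

locale newton_setting =
  fixes C :: "'e::euclidean_space \<Rightarrow> 'l::real_inner"
    and Proj :: "'e \<Rightarrow> 'e \<Rightarrow>\<^sub>L 'e" and F :: "'e \<Rightarrow> 'e" and N :: "'e set"
    and Xs :: 'e and T :: "('e \<times> 'e) set" and r :: "'e \<times> 'e \<Rightarrow> 'e"
  assumes fin_dim: "finite_dimensional TYPE('l)"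
    and C_C3: "C3_on UNIV C"
    and C_surj: "\<forall>X\<in>constraint_set C. surj (frechet_derivative C (at X))"
    and Proj: "projection_function C Proj"
    and N: "constraint_set C \<subseteq> N" and F_C3: "C3_on N F"
    and Proj_F: "\<forall>X\<in>constraint_set C. blinfun_apply (Proj X) (F X) = F X"
    and Xs: "Xs \<in> constraint_set C" and F_Xs: "F Xs = 0"
    and retr: "retraction_around C T r Xs"
    and bij: "bij_betw (\<lambda>\<eta>. blinfun_apply (Proj Xs) (frechet_derivative F (at Xs) \<eta>))
           (tangent_space C Xs) (range (blinfun_apply (Proj Xs)))"
begin

abbreviation "M \<equiv> constraint_set C"
abbreviation "TS \<equiv> tangent_space C"

lemma C_linear: "linear (frechet_derivative C (at X))"
proof -
  have "C differentiable (at X)"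
    using C_C3 unfolding C3_on_def differentiable_def by blast
  then show ?thesis by (simp add: linear_frechet_derivative)
qed

lemma subspace_TS: "subspace (TS X)"
  using linear_subspace_kernel[OF C_linear] by (simp add: tangent_space_def)

lemma rank_Proj_le:
  assumes "X \<in> M"
  shows "dim (range (blinfun_apply (Proj X))) \<le> dim (TS X)"
proof -
  have "dim (range (blinfun_apply (Proj X))) = DIM('e) - dim (UNIV :: 'l set)"
    using Proj assms unfolding projection_function_def by blast
  then show ?thesis
    using DIM_le_dim_kernel_plus_dim[OF fin_dim C_linear, of X] by (simp add: tangent_space_def)
qed

lemma Proj_calm:
  obtains KP where "0 \<le> KP" "\<forall>\<^sub>F X in nhds Xs. X \<in> M \<longrightarrow> norm (Proj X - Proj Xs) \<le> KP * norm (X - Xs)"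
proof -
  obtain U P where U: "Xs \<in> U" "C3_on U P" and eq: "\<forall>Y\<in>M \<inter> U. Proj Y = P Y"
    using Proj Xs unfolding projection_function_def C3_on_subset_def by blast
  obtain P1 P2 d K where P: "taylor_ball P P1 P2 Xs d K" and sub: "ball Xs d \<subseteq> U"
    using C3_on_taylor_ball[OF U(2,1)] by blast
  interpret P: taylor_ball P P1 P2 Xs d K by (rule P)
  have agree: "Proj X = P X" if "X \<in> M" "X \<in> ball Xs d" for X
    using eq that subsetD[OF sub that(2)] by blast
  have "\<forall>\<^sub>F X in nhds Xs. X \<in> ball Xs d"
    by (rule eventually_nhds_in_open[OF open_ball P.center])
  then have "\<forall>\<^sub>F X in nhds Xs. X \<in> M \<longrightarrow> norm (Proj X - Proj Xs) \<le> K * norm (X - Xs)"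
  proof eventually_elim
    case (elim X)
    show ?case using P.lip0[OF P.center elim] agree[OF _ elim] agree[OF Xs P.center] by simp
  qed
  then show ?thesis using that P.K_nonneg by blast
qed

text \<open>The retraction is smooth only on a subset of the tangent bundle; near \<open>(Xs, 0)\<close> it is the
  restriction of a smooth map \<open>g\<close> on the ambient space, to which the Taylor estimates apply.  One
  radius \<open>\<rho>\<close> is chosen for the base point and for the tangent vector.\<close>

lemma retraction_taylor:
  obtains g g1 g2 dg Kg \<rho> where "taylor_ball g g1 g2 (Xs, 0) dg Kg" "0 < \<rho>" "2 * \<rho> \<le> dg"
    "\<forall>X\<in>M. \<forall>\<xi>\<in>TS X. norm (X - Xs) < \<rho> \<longrightarrow> norm \<xi> < \<rho> \<longrightarrow>
      (X, \<xi>) \<in> T \<and> r (X, \<xi>) = g (X, \<xi>)"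
proof -
  obtain \<Omega> \<rho>0 where \<Omega>: "openin (top_of_set M) \<Omega>" "Xs \<in> \<Omega>" and \<rho>0: "\<rho>0 > 0"
    and in_T: "{(X, \<eta>) \<in> tangent_bundle C. X \<in> \<Omega> \<and> norm \<eta> < \<rho>0} \<subseteq> T"
    and C3: "C3_on_subset T r"
    using retr unfolding retraction_around_def by blast
  obtain W where W: "open W" "\<Omega> = M \<inter> W" using \<Omega>(1) by (auto simp: openin_open)
  have inT: "(X, \<xi>) \<in> T" if "X \<in> M" "X \<in> W" "\<xi> \<in> TS X" "norm \<xi> < \<rho>0" for X \<xi>
    using in_T that W(2) by (auto simp: tangent_bundle_def)
  have "(Xs, 0) \<in> T" using inT Xs \<Omega> W \<rho>0 subspace_TS by (simp add: subspace_0)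
  then obtain U g where U: "(Xs, 0) \<in> U" "C3_on U g" and eq: "\<forall>y\<in>T \<inter> U. r y = g y"
    using C3 unfolding C3_on_subset_def by blast
  obtain g1 g2 dg Kg where g: "taylor_ball g g1 g2 (Xs, 0) dg Kg" and sub: "ball (Xs, 0) dg \<subseteq> U"
    using C3_on_taylor_ball[OF U(2,1)] by blast
  interpret g: taylor_ball g g1 g2 "(Xs, 0)" dg Kg by (rule g)
  obtain \<rho>1 where \<rho>1: "\<rho>1 > 0" "ball Xs \<rho>1 \<subseteq> W"
    using W \<Omega>(2) open_contains_ball by blast
  define \<rho> where "\<rho> = min \<rho>0 (min \<rho>1 (dg / 2))"
  have le: "\<rho> \<le> \<rho>0" "\<rho> \<le> \<rho>1" "2 * \<rho> \<le> dg" and pos: "0 < \<rho>"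
    using \<rho>0 \<rho>1 g.d_pos by (auto simp: \<rho>_def)
  have "(X, \<xi>) \<in> T \<and> r (X, \<xi>) = g (X, \<xi>)"
    if "X \<in> M" "\<xi> \<in> TS X" "norm (X - Xs) < \<rho>" "norm \<xi> < \<rho>" for X \<xi>
  proof -
    have "norm (Xs - X) < \<rho>1" using that(3) le by (simp add: norm_minus_commute)
    then have "X \<in> W" using \<rho>1(2) by (auto simp: dist_norm)
    then have T: "(X, \<xi>) \<in> T" using inT that le by simp
    have "norm (X - Xs, \<xi>) \<le> norm (X - Xs) + norm \<xi>" by (rule norm_Pair_le)
    then have "norm ((X, \<xi>) - (Xs, 0)) < dg" using that le by simp
    then have "(X, \<xi>) \<in> ball (Xs, 0) dg" by (metis dist_commute dist_norm mem_ball)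
    then show ?thesis using T eq sub by blast
  qed
  then show ?thesis by (intro that[OF g pos le(3)]) blast
qed

end

text \<open>Taylor data for \<open>C\<close>, \<open>F\<close> and the extension \<open>g\<close> of the retraction are fixed once for all estimates.
  The condition \<open>2 * \<rho> \<le> dg\<close> ensures that \<open>(X, \<xi>)\<close> lies in the ball on which \<open>g\<close> is controlled.\<close>

locale newton_local = newton_setting C Proj F N Xs T r
    + CT: taylor_ball C C1 C2 Xs dC KC + FT: taylor_ball F F1 F2 Xs dF KF
    + gT: taylor_ball g g1 g2 "(Xs, 0)" dg Kg
  for C :: "'e::euclidean_space \<Rightarrow> 'l::real_inner" and Proj F N Xs T r
    and C1 C2 dC KC F1 F2 dF KF g g1 g2 dg Kg +
  fixes KP \<rho> :: real
  assumes KP_nonneg: "0 \<le> KP"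
    and KP: "\<forall>\<^sub>F X in nhds Xs. X \<in> constraint_set C \<longrightarrow> norm (Proj X - Proj Xs) \<le> KP * norm (X - Xs)"
    and rho: "0 < \<rho>" "2 * \<rho> \<le> dg"
    and r_eq: "\<forall>X\<in>constraint_set C. \<forall>\<xi>\<in>tangent_space C X. norm (X - Xs) < \<rho> \<longrightarrow>
      norm \<xi> < \<rho> \<longrightarrow> (X, \<xi>) \<in> T \<and> r (X, \<xi>) = g (X, \<xi>)"
begin

lemma TS_eq: "X \<in> ball Xs dC \<Longrightarrow> TS X = {\<eta>. C1 X \<eta> = 0}"
  using frechet_derivative_at[OF CT.D1] by (simp add: tangent_space_def)

lemma F1_eq: "X \<in> ball Xs dF \<Longrightarrow> frechet_derivative F (at X) = blinfun_apply (F1 X)"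
  using frechet_derivative_at[OF FT.D1] by simp

lemma F_calm: "\<forall>\<^sub>F X in nhds Xs. norm (F X) \<le> KF * norm (X - Xs)"
  using FT.near by eventually_elim (use FT.lip0[OF FT.center] F_Xs in auto)

lemma C1_tangent_le:
  "\<forall>\<^sub>F X in nhds Xs. \<forall>\<eta>\<in>TS X. norm (C1 Xs \<eta>) \<le> KC * norm (X - Xs) * norm \<eta>"
  using CT.near
proof eventually_elim
  case (elim X)
  show ?case
  proof
    fix \<eta> assume "\<eta> \<in> TS X"
    then have "C1 Xs \<eta> = (C1 Xs - C1 X) \<eta>" using TS_eq[OF elim] by (simp add: blinfun.diff_left)
    also have "norm \<dots> \<le> norm (C1 Xs - C1 X) * norm \<eta>" by (rule norm_blinfun)
    also have "norm (C1 Xs - C1 X) \<le> KC * norm (X - Xs)"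
      using CT.lip1[OF CT.center elim] by (simp add: norm_minus_commute)
    finally show "norm (C1 Xs \<eta>) \<le> KC * norm (X - Xs) * norm \<eta>"
      by (simp add: mult_right_mono)
  qed
qed

text \<open>The operator \<open>v \<mapsto> (Proj Xs (F1 Xs v), C1 Xs v)\<close> is injective on the whole space: a vector killed by
  \<open>C1 Xs\<close> is tangent, and on tangent vectors the first component is injective.  The lower bound
  replaces a local parametrization of \<open>M\<close>, and both the invertibility of the linear systems and the
  control of the distance to \<open>Xs\<close> follow from it by perturbation.\<close>

definition "c0 = (SOME c. c > 0 \<and> (\<forall>v. norm v \<le> c * (norm (Proj Xs (F1 Xs v)) + norm (C1 Xs v))))"

lemma c0: "c0 > 0" "norm v \<le> c0 * (norm (Proj Xs (F1 Xs v)) + norm (C1 Xs v))"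
proof -
  have "v = 0" if "(Proj Xs o\<^sub>L F1 Xs) v = 0" "C1 Xs v = 0" for v
  proof -
    have "v \<in> TS Xs" "0 \<in> TS Xs"
      using that TS_eq[OF CT.center] by (simp_all add: blinfun.zero_right)
    moreover have "inj_on (\<lambda>\<eta>. Proj Xs (F1 Xs \<eta>)) (TS Xs)"
      using bij F1_eq[OF FT.center] by (simp add: bij_betw_def)
    ultimately show ?thesis
      using that(1) inj_onD[of "\<lambda>\<eta>. Proj Xs (F1 Xs \<eta>)" "TS Xs" v 0] by (simp add: blinfun.zero_right)
  qed
  then obtain c where "c > 0" "\<And>v. norm v \<le> c * (norm ((Proj Xs o\<^sub>L F1 Xs) v) + norm (C1 Xs v))"
    using bounded_below_of_trivial_common_kernel[of "Proj Xs o\<^sub>L F1 Xs" "C1 Xs"] by blast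
  then have "\<exists>c. c > 0 \<and> (\<forall>v. norm v \<le> c * (norm (Proj Xs (F1 Xs v)) + norm (C1 Xs v)))" by auto
  from someI_ex[OF this] show "c0 > 0" "norm v \<le> c0 * (norm (Proj Xs (F1 Xs v)) + norm (C1 Xs v))"
    unfolding c0_def by blast+
qed

lemma Proj_bounded: "\<forall>\<^sub>F X in nhds Xs. X \<in> M \<longrightarrow> norm (Proj X) \<le> norm (Proj Xs) + 1"
  using KP eventually_small[of 1 KP Xs, simplified]
proof eventually_elim
  case (elim X)
  then show ?case using norm_triangle_sub[of "Proj X" "Proj Xs"] by auto
qed

text \<open>For \<open>\<eta>\<close> tangent at \<open>X\<close>, passing from \<open>Xs\<close> to \<open>X\<close> changes both components of the operator by
  \<open>O(norm (X - Xs) * norm \<eta>)\<close>, which is absorbed on the left for \<open>X\<close> close to \<open>Xs\<close>.\<close>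

lemma inverse_bounded:
  "\<exists>K. 0 \<le> K \<and> (\<forall>\<^sub>F X in nhds Xs. X \<in> M \<longrightarrow> (\<forall>\<eta>\<in>TS X. norm \<eta> \<le> K * norm (Proj X (F1 X \<eta>))))"
proof (intro exI conjI)
  let ?k = "norm (Proj Xs) * KF + KP * KF"
  show "0 \<le> 2 * c0" using c0(1) by simp
  show "\<forall>\<^sub>F X in nhds Xs. X \<in> M \<longrightarrow> (\<forall>\<eta>\<in>TS X. norm \<eta> \<le> (2 * c0) * norm (Proj X (F1 X \<eta>)))"
    using FT.near C1_tangent_le KP eventually_small[of "1/2" "c0 * (?k + KC)" Xs, simplified]
  proof eventually_elim
    case (elim X)
    show ?case
    proof (intro impI ballI)
      fix \<eta> assume X: "X \<in> M" and \<eta>: "\<eta> \<in> TS X"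
      let ?e = "norm (X - Xs)"
      have "Proj Xs (F1 Xs \<eta>) = Proj X (F1 X \<eta>) - Proj Xs ((F1 X - F1 Xs) \<eta>) - (Proj X - Proj Xs) (F1 X \<eta>)"
        by (simp add: blinfun.bilinear_simps)
      also have "norm \<dots> \<le> norm (Proj X (F1 X \<eta>)) + norm (Proj Xs ((F1 X - F1 Xs) \<eta>))
          + norm ((Proj X - Proj Xs) (F1 X \<eta>))"
        by (rule order_trans[OF norm_triangle_ineq4 add_right_mono[OF norm_triangle_ineq4]])
      also have "norm (Proj Xs ((F1 X - F1 Xs) \<eta>)) \<le> norm (Proj Xs) * ((KF * ?e) * norm \<eta>)"
        by (intro norm_blinfun_le order_refl FT.lip1 FT.center elim)
      also have "norm ((Proj X - Proj Xs) (F1 X \<eta>)) \<le> (KP * ?e) * (KF * norm \<eta>)"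
        using elim(3) X by (intro norm_blinfun_le order_refl FT.bound1 elim) auto
      finally have "norm (Proj Xs (F1 Xs \<eta>)) \<le> norm (Proj X (F1 X \<eta>)) + ?k * ?e * norm \<eta>"
        by (simp add: algebra_simps)
      moreover have "norm (C1 Xs \<eta>) \<le> KC * ?e * norm \<eta>" using elim(2) \<eta> by blast
      ultimately have "norm (Proj Xs (F1 Xs \<eta>)) + norm (C1 Xs \<eta>)
          \<le> norm (Proj X (F1 X \<eta>)) + (?k + KC) * ?e * norm \<eta>"
        by (simp add: algebra_simps)
      from order_trans[OF c0(2) mult_left_mono[OF this]]
      have "norm \<eta> \<le> c0 * norm (Proj X (F1 X \<eta>)) + (c0 * (?k + KC) * ?e) * norm \<eta>"
        using c0(1) by (simp add: algebra_simps)
      also have "(c0 * (?k + KC) * ?e) * norm \<eta> \<le> (1/2) * norm \<eta>"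
        using elim(4) by (intro mult_right_mono) auto
      finally show "norm \<eta> \<le> (2 * c0) * norm (Proj X (F1 X \<eta>))" by simp
    qed
  qed
qed

text \<open>Injectivity comes from the lower bound.  It gives surjectivity because the tangent space has at
  least the dimension of the range of the projection.\<close>

lemma solvable:
  "\<forall>\<^sub>F X in nhds Xs. X \<in> M \<longrightarrow> (\<forall>b\<in>range (blinfun_apply (Proj X)). \<exists>!\<eta>. solves_projected C Proj F X b \<eta>)"
proof -
  obtain K where "\<forall>\<^sub>F X in nhds Xs. X \<in> M \<longrightarrow> (\<forall>\<eta>\<in>TS X. norm \<eta> \<le> K * norm (Proj X (F1 X \<eta>)))"
    using inverse_bounded by blast
  then show ?thesis
    using FT.near
  proof eventually_elim
    case (elim X)
    show ?case
    proof (intro impI ballI)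
      fix b assume X: "X \<in> M" and b: "b \<in> range (blinfun_apply (Proj X))"
      have "bij_betw (\<lambda>\<eta>. Proj X (F1 X \<eta>)) (TS X) (range (blinfun_apply (Proj X)))"
      proof (rule linear_onto_of_dim[OF _ subspace_TS _ _ rank_Proj_le[OF X]])
        show "linear (\<lambda>\<eta>. Proj X (F1 X \<eta>))"
          by (intro bounded_linear.linear bounded_linear_intros)
        show "subspace (range (blinfun_apply (Proj X)))"
          by (intro linear_subspace_image subspace_UNIV bounded_linear.linear blinfun.bounded_linear_right)
        show "v = 0" if "v \<in> TS X" "Proj X (F1 X v) = 0" for v
          using elim(1) X that by fastforce
      qed auto
      then have inj: "inj_on (\<lambda>\<eta>. Proj X (F1 X \<eta>)) (TS X)"
        and onto: "b \<in> (\<lambda>\<eta>. Proj X (F1 X \<eta>)) ` TS X"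
        using b by (simp_all add: bij_betw_def)
      from onto obtain \<eta> where \<eta>: "\<eta> \<in> TS X" "b = Proj X (F1 X \<eta>)" by (elim imageE)
      have "\<exists>!\<eta>. \<eta> \<in> TS X \<and> Proj X (F1 X \<eta>) = b"
      proof (rule ex1I[of _ \<eta>])
        show "\<zeta> = \<eta>" if "\<zeta> \<in> TS X \<and> Proj X (F1 X \<zeta>) = b" for \<zeta>
          using inj_onD[OF inj, of \<zeta> \<eta>] that \<eta> by simp
      qed (simp add: \<eta>)
      then show "\<exists>!\<eta>. solves_projected C Proj F X b \<eta>"
        by (simp add: solves_projected_def F1_eq[OF elim(2)])
    qed
  qed
qed

text \<open>The lower bound is applied to \<open>Y - Xs\<close>: since \<open>C\<close> vanishes at both points and \<open>F Xs = 0\<close>, its two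
  components are quadratically close to \<open>0\<close> and to \<open>Proj Xs (F Y)\<close>.  Replacing \<open>Proj Xs\<close> by \<open>Proj X\<close>
  costs a small multiple of \<open>norm (Y - Xs)\<close>.\<close>

lemma distance_bounded:
  "\<exists>K d. 0 \<le> K \<and> 0 < d \<and> (\<forall>\<^sub>F X in nhds Xs. X \<in> M \<longrightarrow>
     (\<forall>Y\<in>M. norm (Y - Xs) < d \<longrightarrow> norm (Y - Xs) \<le> K * norm (Proj X (F Y))))"
proof -
  let ?k = "KC + norm (Proj Xs) * KF"
  have "\<forall>\<^sub>F Y in nhds Xs. Y \<in> ball Xs dC \<and> Y \<in> ball Xs dF \<and> c0 * ?k * norm (Y - Xs) < 1/2"
    using CT.near FT.near eventually_small[of "1/2" "c0 * ?k" Xs, simplified] by eventually_elim auto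
  then obtain d where d: "d > 0" "\<And>Y. norm (Y - Xs) < d \<Longrightarrow>
      Y \<in> ball Xs dC \<and> Y \<in> ball Xs dF \<and> c0 * ?k * norm (Y - Xs) < 1/2"
    unfolding eventually_nhds_metric dist_norm by blast
  have at_Xs: "norm (Y - Xs) \<le> (2 * c0) * norm (Proj Xs (F Y))" if Y: "Y \<in> M" "norm (Y - Xs) < d" for Y
  proof -
    let ?y = "Y - Xs"
    note near = d(2)[OF Y(2)]
    have "norm (C Y - C Xs - C1 Xs ?y) \<le> KC * norm ?y ^ 2"
      using CT.rem0[OF CT.center] near by blast
    then have 1: "norm (C1 Xs ?y) \<le> KC * norm ?y ^ 2"
      using Y Xs by (simp add: constraint_set_def)
    have "norm (F Y - F Xs - F1 Xs ?y) \<le> KF * norm ?y ^ 2"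
      using FT.rem0[OF FT.center] near by blast
    then have "norm (F Y - F1 Xs ?y) \<le> KF * norm ?y ^ 2" using F_Xs by simp
    then have "norm (Proj Xs (F Y - F1 Xs ?y)) \<le> norm (Proj Xs) * (KF * norm ?y ^ 2)"
      by (intro norm_blinfun_le order_refl)
    moreover have eq: "Proj Xs (F1 Xs ?y) = Proj Xs (F Y) - Proj Xs (F Y - F1 Xs ?y)"
      by (simp add: blinfun.diff_right)
    ultimately have "norm (Proj Xs (F1 Xs ?y)) \<le> norm (Proj Xs (F Y)) + norm (Proj Xs) * (KF * norm ?y ^ 2)"
      unfolding eq
      using norm_triangle_ineq4[of "Proj Xs (F Y)" "Proj Xs (F Y - F1 Xs ?y)"] by linarith
    with 1 have "norm (Proj Xs (F1 Xs ?y)) + norm (C1 Xs ?y) \<le> norm (Proj Xs (F Y)) + ?k * norm ?y * norm ?y"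
      by (simp add: algebra_simps power2_eq_square)
    from order_trans[OF c0(2) mult_left_mono[OF this]]
    have "norm ?y \<le> c0 * norm (Proj Xs (F Y)) + (c0 * ?k * norm ?y) * norm ?y"
      using c0(1) by (simp add: algebra_simps)
    also have "(c0 * ?k * norm ?y) * norm ?y \<le> (1/2) * norm ?y"
      using near by (intro mult_right_mono) auto
    finally show ?thesis by simp
  qed
  have "\<forall>\<^sub>F X in nhds Xs. X \<in> M \<longrightarrow>
     (\<forall>Y\<in>M. norm (Y - Xs) < d \<longrightarrow> norm (Y - Xs) \<le> (4 * c0) * norm (Proj X (F Y)))"
    using KP eventually_small[of "1/4" "c0 * KP * KF" Xs, simplified]
  proof eventually_elim
    case (elim X)
    show ?case
    proof (intro impI ballI)
      fix Y assume X: "X \<in> M" and Y: "Y \<in> M" "norm (Y - Xs) < d"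
      let ?y = "Y - Xs"
      have "norm (F Y) \<le> KF * norm ?y"
        using FT.lip0[OF FT.center] d(2)[OF Y(2)] F_Xs by fastforce
      then have "norm ((Proj X - Proj Xs) (F Y)) \<le> (KP * norm (X - Xs)) * (KF * norm ?y)"
        using elim(1) X by (intro norm_blinfun_le) auto
      moreover have eq: "Proj Xs (F Y) = Proj X (F Y) - (Proj X - Proj Xs) (F Y)"
        by (simp add: blinfun.diff_left)
      ultimately have "norm (Proj Xs (F Y)) \<le> norm (Proj X (F Y)) + KP * KF * norm (X - Xs) * norm ?y"
        using norm_triangle_ineq4[of "Proj X (F Y)" "(Proj X - Proj Xs) (F Y)"]
        by (simp only: eq[symmetric] mult_ac)
      from order_trans[OF at_Xs[OF Y] mult_left_mono[OF this]]
      have "norm ?y \<le> 2 * c0 * norm (Proj X (F Y)) + 2 * ((c0 * KP * KF * norm (X - Xs)) * norm ?y)"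
        using c0(1) by (simp add: algebra_simps)
      also have "(c0 * KP * KF * norm (X - Xs)) * norm ?y \<le> (1/4) * norm ?y"
        using elim(2) by (intro mult_right_mono) auto
      finally show "norm ?y \<le> (4 * c0) * norm (Proj X (F Y))" by simp
    qed
  qed
  then show ?thesis using d(1) c0(1) by (intro exI[of _ "4 * c0"] exI[of _ d]) auto
qed

text \<open>The tangent vector \<open>\<zeta>\<close> at \<open>Xs\<close> is chosen to have the same image as \<open>\<eta>\<close> under the first component of
  the operator, so that only \<open>C1 Xs \<eta>\<close> contributes to the lower bound for \<open>\<eta> - \<zeta>\<close>.\<close>

lemma tangent_transfer:
  "\<forall>\<^sub>F X in nhds Xs. \<forall>\<eta>\<in>TS X. \<exists>\<zeta>\<in>TS Xs. norm (\<eta> - \<zeta>) \<le> c0 * KC * norm (X - Xs) * norm \<eta>"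
  using C1_tangent_le
proof eventually_elim
  case (elim X)
  show ?case
  proof
    fix \<eta> assume \<eta>: "\<eta> \<in> TS X"
    have "Proj Xs (F1 Xs \<eta>) \<in> (\<lambda>\<eta>. Proj Xs (F1 Xs \<eta>)) ` TS Xs"
      using bij F1_eq[OF FT.center] by (auto simp: bij_betw_def)
    then obtain \<zeta> where \<zeta>: "\<zeta> \<in> TS Xs" "Proj Xs (F1 Xs \<eta>) = Proj Xs (F1 Xs \<zeta>)" by blast
    have "norm (\<eta> - \<zeta>) \<le> c0 * (norm (Proj Xs (F1 Xs (\<eta> - \<zeta>))) + norm (C1 Xs (\<eta> - \<zeta>)))"
      by (rule c0(2))
    also have "\<dots> = c0 * norm (C1 Xs \<eta>)"
      using \<zeta> TS_eq[OF CT.center] by (simp add: blinfun.diff_right)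
    also have "\<dots> \<le> c0 * (KC * norm (X - Xs) * norm \<eta>)"
      using elim \<eta> c0(1) by (intro mult_left_mono) auto
    finally show "\<exists>\<zeta>\<in>TS Xs. norm (\<eta> - \<zeta>) \<le> c0 * KC * norm (X - Xs) * norm \<eta>"
      using \<zeta>(1) by (auto simp: mult.assoc)
  qed
qed

end

section \<open>Third-order steps\<close>

context newton_local
begin

text \<open>The two properties of a quadratic form that the convergence proofs use.  Only projected residuals
  are compared, which leaves the freedom to drop terms that the projection annihilates; this is
  what admits \<open>GL\<close> besides \<open>G\<close>.\<close>

definition quadratic_model :: "('e \<Rightarrow> 'e \<Rightarrow> 'e \<Rightarrow> 'e) \<Rightarrow> bool" where
  "quadratic_model B \<longleftrightarrow> calm_bilinear Xs B \<and> (\<exists>K \<rho>'. 0 \<le> K \<and> 0 < \<rho>' \<and>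
     (\<forall>\<^sub>F X in nhds Xs. X \<in> M \<longrightarrow> (\<forall>\<xi>\<in>TS X. norm \<xi> < \<rho>' \<longrightarrow>
        norm (Proj X (F (r (X, \<xi>))) - (F X + Proj X (F1 X \<xi>) + (1/2) *\<^sub>R Proj X (B X \<xi> \<xi>)))
          \<le> K * norm \<xi> ^ 3)))"

text \<open>The forms \<open>G\<close> and \<open>GL\<close> are functions of one tangent vector.  The bilinear map is a separate object,
  defined on all ambient vectors, so that values at neighbouring base points can be compared.\<close>

definition represents :: "('e \<Rightarrow> 'e \<Rightarrow> 'e \<Rightarrow> 'e) \<Rightarrow> ('e \<Rightarrow> 'e \<Rightarrow> 'e) \<Rightarrow> bool" where
  "represents B G \<longleftrightarrow> (\<forall>\<^sub>F X in nhds Xs. X \<in> M \<longrightarrow> (\<forall>\<eta>\<in>TS X. G X \<eta> = B X \<eta> \<eta>))"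

lemma in_domain:
  assumes "X \<in> M" "\<xi> \<in> TS X" "norm (X - Xs) < \<rho>" "norm \<xi> < \<rho>"
  shows "(X, \<xi>) \<in> T" "r (X, \<xi>) = g (X, \<xi>)" "(X, \<xi>) \<in> ball (Xs, 0) dg" "r (X, \<xi>) \<in> M"
proof -
  show T: "(X, \<xi>) \<in> T" and "r (X, \<xi>) = g (X, \<xi>)" using r_eq assms by blast+
  have "norm (X - Xs, \<xi>) \<le> norm (X - Xs) + norm \<xi>" by (rule norm_Pair_le)
  then have "norm ((X, \<xi>) - (Xs, 0)) < dg" using assms rho by simp
  then show "(X, \<xi>) \<in> ball (Xs, 0) dg" by (metis dist_commute dist_norm mem_ball)
  show "r (X, \<xi>) \<in> M" using T retr unfolding retraction_around_def by blast
qed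

lemma retraction_0:
  assumes "X \<in> M" "norm (X - Xs) < \<rho>"
  shows "g (X, 0) = X" "r (X, 0) = X" "(X, 0::'e) \<in> ball (Xs, 0) dg"
    and "((\<lambda>\<eta>. r (X, \<eta>)) has_derivative (\<lambda>\<eta>. \<eta>)) (at 0 within TS X)"
proof -
  have 0: "0 \<in> TS X" "norm (0::'e) < \<rho>" using subspace_TS rho by (simp_all add: subspace_0)
  note dom = in_domain[OF assms(1) 0(1) assms(2) 0(2)]
  show "r (X, 0) = X" using retr dom(1) unfolding retraction_around_def by blast
  then show "g (X, 0) = X" using dom(2) by simp
  show "(X, 0::'e) \<in> ball (Xs, 0) dg" by (rule dom(3))
  show "((\<lambda>\<eta>. r (X, \<eta>)) has_derivative (\<lambda>\<eta>. \<eta>)) (at 0 within TS X)"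
    using retr dom(1) unfolding retraction_around_def by blast
qed

lemma g_partial:
  assumes "(X, \<xi>) \<in> ball (Xs, 0) dg"
  shows "((\<lambda>\<xi>. g (X, \<xi>)) has_derivative (\<lambda>w. g1 (X, \<xi>) (0, w))) (at \<xi>)"
  by (rule has_derivative_compose[where f = "\<lambda>\<xi>. (X, \<xi>)" and f' = "\<lambda>w. (0, w)", OF _ gT.D1[OF assms]])
    (auto intro!: derivative_eq_intros)

text \<open>The normalization of the retraction speaks of \<open>r\<close> within the tangent space only, and is transferred
  to the ambient derivative of \<open>g\<close> on tangent vectors.\<close>

lemma g1_tangent:
  assumes X: "X \<in> M" "norm (X - Xs) < \<rho>" and \<xi>: "\<xi> \<in> TS X"
  shows "g1 (X, 0) (0, \<xi>) = \<xi>"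
proof -
  have 0: "0 \<in> TS X" using subspace_TS by (simp add: subspace_0)
  have "((\<lambda>\<eta>. r (X, \<eta>)) has_derivative (\<lambda>w. g1 (X, 0) (0, w))) (at 0 within TS X)"
    by (rule has_derivative_transform_within[OF has_derivative_at_withinI[OF g_partial[OF retraction_0(3)[OF X]]] rho(1) 0])
      (use in_domain[OF X(1) _ X(2)] in simp)
  from has_derivative_within_subspace_unique[OF subspace_TS 0 \<xi> this retraction_0(4)[OF X]]
  show ?thesis .
qed

lemma retraction_etaeta_eq:
  assumes X: "X \<in> M" "norm (X - Xs) < \<rho>" and \<eta>: "\<eta> \<in> TS X"
  shows "retraction_etaeta C r X \<eta> = g2 (X, 0) (0, \<eta>) (0, \<eta>)"
proof -
  define U where "U = {\<xi>::'e. (X, \<xi>) \<in> ball (Xs, 0) dg \<and> norm \<xi> < \<rho>}"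
  have "open (Pair X -` ball (Xs, 0::'e) dg)"
    by (intro open_vimage continuous_intros) auto
  moreover have "open {\<xi>::'e. norm \<xi> < \<rho>}"
    by (intro open_Collect_less continuous_intros)
  moreover have "U = Pair X -` ball (Xs, 0) dg \<inter> {\<xi>. norm \<xi> < \<rho>}" by (auto simp: U_def)
  ultimately have U: "open U" by (simp only: open_Int)
  show ?thesis
    unfolding retraction_etaeta_def
  proof (rule second_derivative_eq[where U = U and h = "\<lambda>\<xi>. g (X, \<xi>)"
        and ?h1.0 = "\<lambda>\<xi> w. g1 (X, \<xi>) (0, w)" and ?h2.0 = "\<lambda>v. g2 (X, 0) (0, v) (0, \<eta>)",
        OF subspace_TS U])
  show "0 \<in> TS X" using subspace_TS by (simp add: subspace_0)
  show "0 \<in> U"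
    using retraction_0(3)[OF X] rho(1) by (simp add: U_def)
  show "r (X, \<xi>) = g (X, \<xi>)" if "\<xi> \<in> TS X" "\<xi> \<in> U" for \<xi>
    using in_domain(2)[OF X(1) that(1) X(2)] that(2) by (simp add: U_def)
  show "((\<lambda>\<xi>. g (X, \<xi>)) has_derivative (\<lambda>w. g1 (X, \<xi>) (0, w))) (at \<xi>)"
    if "\<xi> \<in> U" for \<xi>
    using that by (intro g_partial) (simp add: U_def)
  have "((\<lambda>\<xi>. g1 (X, \<xi>)) has_derivative (\<lambda>v. g2 (X, 0) (0, v))) (at 0)"
    by (rule has_derivative_compose[where f = "\<lambda>\<xi>. (X, \<xi>)" and f' = "\<lambda>w. (0, w)",
          OF _ gT.D2[OF retraction_0(3)[OF X]]])
      (auto intro!: derivative_eq_intros)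
  then show "((\<lambda>\<xi>. g1 (X, \<xi>) (0, \<eta>)) has_derivative (\<lambda>v. g2 (X, 0) (0, v) (0, \<eta>))) (at 0)"
    by (auto intro!: derivative_eq_intros)
qed (fact \<eta>)+
qed

lemma retraction_expansion:
  assumes X: "X \<in> M" "norm (X - Xs) < \<rho>" and \<xi>: "\<xi> \<in> TS X" "norm \<xi> < \<rho>"
  shows "norm (r (X, \<xi>) - X) \<le> Kg * norm \<xi>"
    and "norm (r (X, \<xi>) - X - \<xi>) \<le> Kg * norm \<xi> ^ 2"
    and "norm (r (X, \<xi>) - X - \<xi> - (1/2) *\<^sub>R g2 (X, 0) (0, \<xi>) (0, \<xi>)) \<le> Kg * norm \<xi> ^ 3"
proof -
  note dom = in_domain[OF X(1) \<xi>(1) X(2) \<xi>(2)] and 0 = retraction_0[OF X]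
  show "norm (r (X, \<xi>) - X) \<le> Kg * norm \<xi>"
    using gT.lip0[OF 0(3) dom(3)] by (simp add: 0 dom(2))
  show "norm (r (X, \<xi>) - X - \<xi>) \<le> Kg * norm \<xi> ^ 2"
    using gT.rem0[OF 0(3) dom(3)] by (simp add: 0 dom(2) g1_tangent[OF X \<xi>(1)])
  show "norm (r (X, \<xi>) - X - \<xi> - (1/2) *\<^sub>R g2 (X, 0) (0, \<xi>) (0, \<xi>)) \<le> Kg * norm \<xi> ^ 3"
    using gT.taylor2[OF 0(3) dom(3)] by (simp add: 0 dom(2) g1_tangent[OF X \<xi>(1)])
qed

text \<open>The hypothesis bounds the quadratic polynomial that approximates the projected residual of the
  new point; the remainder of the model is of third order because the increment is \<open>O(e)\<close>.\<close>

lemma third_order_step: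
  assumes model: "quadratic_model B" and k: "0 \<le> k"
  obtains c where "\<forall>\<^sub>F X in nhds Xs. X \<in> M \<longrightarrow> (\<forall>\<xi>\<in>TS X. norm \<xi> \<le> k * norm (X - Xs) \<longrightarrow>
    norm (F X + Proj X (F1 X \<xi>) + (1/2) *\<^sub>R Proj X (B X \<xi> \<xi>)) \<le> k * norm (X - Xs) ^ 3 \<longrightarrow>
    (X, \<xi>) \<in> T \<and> r (X, \<xi>) \<in> M \<and> norm (r (X, \<xi>) - Xs) \<le> c * norm (X - Xs) ^ 3)"
proof -
  obtain K \<rho>' where K: "0 \<le> K" and \<rho>': "0 < \<rho>'" and exp:
    "\<forall>\<^sub>F X in nhds Xs. X \<in> M \<longrightarrow> (\<forall>\<xi>\<in>TS X. norm \<xi> < \<rho>' \<longrightarrow>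
        norm (Proj X (F (r (X, \<xi>))) - (F X + Proj X (F1 X \<xi>) + (1/2) *\<^sub>R Proj X (B X \<xi> \<xi>)))
          \<le> K * norm \<xi> ^ 3)"
    using model unfolding quadratic_model_def by blast
  obtain K2 d where K2: "0 \<le> K2" and d: "0 < d" and dist:
    "\<forall>\<^sub>F X in nhds Xs. X \<in> M \<longrightarrow>
     (\<forall>Y\<in>M. norm (Y - Xs) < d \<longrightarrow> norm (Y - Xs) \<le> K2 * norm (Proj X (F Y)))"
    using distance_bounded by blast
  have "\<forall>\<^sub>F X in nhds Xs. X \<in> M \<longrightarrow> (\<forall>\<xi>\<in>TS X. norm \<xi> \<le> k * norm (X - Xs) \<longrightarrow>
    norm (F X + Proj X (F1 X \<xi>) + (1/2) *\<^sub>R Proj X (B X \<xi> \<xi>)) \<le> k * norm (X - Xs) ^ 3 \<longrightarrow>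
    (X, \<xi>) \<in> T \<and> r (X, \<xi>) \<in> M \<and> norm (r (X, \<xi>) - Xs) \<le> (K2 * (K * k ^ 3 + k)) * norm (X - Xs) ^ 3)"
    using exp dist eventually_small[OF rho(1), of 1 Xs] eventually_small[OF rho(1), of k Xs]
      eventually_small[OF \<rho>', of k Xs] eventually_small[OF d, of "1 + Kg * k" Xs]
  proof eventually_elim
    case (elim X)
    show ?case
    proof (intro impI ballI)
      fix \<xi> assume X: "X \<in> M" and \<xi>: "\<xi> \<in> TS X" and le: "norm \<xi> \<le> k * norm (X - Xs)"
        and defect: "norm (F X + Proj X (F1 X \<xi>) + (1/2) *\<^sub>R Proj X (B X \<xi> \<xi>)) \<le> k * norm (X - Xs) ^ 3"
      let ?Y = "r (X, \<xi>)" and ?e = "norm (X - Xs)"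
      have near: "norm (X - Xs) < \<rho>" "norm \<xi> < \<rho>" "norm \<xi> < \<rho>'" using le elim by auto
      note dom = in_domain[OF X \<xi> near(1,2)]
      have "norm (?Y - Xs) \<le> norm (?Y - X) + ?e"
        using norm_triangle_ineq[of "?Y - X" "X - Xs"] by simp
      also have "norm (?Y - X) \<le> Kg * (k * ?e)"
        using retraction_expansion(1)[OF X near(1) \<xi> near(2)] mult_left_mono[OF le gT.K_nonneg]
        by (rule order_trans)
      finally have "norm (?Y - Xs) < d" using elim(6) by (simp add: distrib_right mult.assoc)
      then have 1: "norm (?Y - Xs) \<le> K2 * norm (Proj X (F ?Y))" using elim(2) X dom(4) by blast
      have "norm (Proj X (F ?Y) - (F X + Proj X (F1 X \<xi>) + (1/2) *\<^sub>R Proj X (B X \<xi> \<xi>))) \<le> K * norm \<xi> ^ 3"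
        using elim(1) X \<xi> near(3) by blast
      also have "K * norm \<xi> ^ 3 \<le> K * (k * ?e) ^ 3"
        by (intro mult_left_mono power_mono le K norm_ge_zero)
      finally have "norm (Proj X (F ?Y)) \<le> K * (k * ?e) ^ 3 + k * ?e ^ 3"
        using norm_triangle_sub[of "Proj X (F ?Y)" "F X + Proj X (F1 X \<xi>) + (1/2) *\<^sub>R Proj X (B X \<xi> \<xi>)"]
          defect by linarith
      then have "norm (Proj X (F ?Y)) \<le> (K * k ^ 3 + k) * ?e ^ 3"
        by (simp add: power_mult_distrib distrib_right mult.assoc)
      from order_trans[OF 1 mult_left_mono[OF this K2]] dom(1,4)
      show "(X, \<xi>) \<in> T \<and> ?Y \<in> M \<and> norm (?Y - Xs) \<le> (K2 * (K * k ^ 3 + k)) * ?e ^ 3"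
        by (simp add: mult.assoc)
    qed
  qed
  then show ?thesis using that by blast
qed

lemma newton_increment:
  obtains k where "0 \<le> k" "\<forall>\<^sub>F X in nhds Xs. X \<in> M \<longrightarrow> (\<exists>!\<eta>. newton_update C Proj F X \<eta>) \<and>
    (\<forall>\<eta>. newton_update C Proj F X \<eta> \<longrightarrow>
      \<eta> \<in> TS X \<and> Proj X (F1 X \<eta>) = - F X \<and> norm \<eta> \<le> k * norm (X - Xs))"
proof -
  obtain K where K: "0 \<le> K" "\<forall>\<^sub>F X in nhds Xs. X \<in> M \<longrightarrow> (\<forall>\<eta>\<in>TS X. norm \<eta> \<le> K * norm (Proj X (F1 X \<eta>)))"
    using inverse_bounded by blast
  have "\<forall>\<^sub>F X in nhds Xs. X \<in> M \<longrightarrow> (\<exists>!\<eta>. newton_update C Proj F X \<eta>) \<and>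
    (\<forall>\<eta>. newton_update C Proj F X \<eta> \<longrightarrow>
      \<eta> \<in> TS X \<and> Proj X (F1 X \<eta>) = - F X \<and> norm \<eta> \<le> (K * KF) * norm (X - Xs))"
    using K(2) solvable FT.near F_calm
  proof eventually_elim
    case (elim X)
    show ?case
    proof (intro impI conjI allI)
      assume X: "X \<in> M"
      have "Proj X (- F X) = - F X" using Proj_F X by (simp add: blinfun.minus_right)
      then have "- F X \<in> range (blinfun_apply (Proj X))" by (metis rangeI)
      then show "\<exists>!\<eta>. newton_update C Proj F X \<eta>"
        using elim(2) X unfolding newton_update_def by blast
      fix \<eta> assume "newton_update C Proj F X \<eta>"
      then show \<eta>: "\<eta> \<in> TS X" "Proj X (F1 X \<eta>) = - F X"
        unfolding newton_update_def solves_projected_def by (simp_all add: F1_eq[OF elim(3)])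
      then have "norm \<eta> \<le> K * norm (F X)" using elim(1) X by (metis norm_minus_cancel)
      also have "\<dots> \<le> K * (KF * norm (X - Xs))" using elim(4) K(1) by (rule mult_left_mono)
      finally show "norm \<eta> \<le> (K * KF) * norm (X - Xs)" by (simp add: mult.assoc)
    qed
  qed
  then show ?thesis using that[of "K * KF"] K(1) FT.K_nonneg by simp
qed

text \<open>The value \<open>Proj X (B X \<eta> \<eta>)\<close> is compared with \<open>Proj Xs (B Xs \<zeta> \<zeta>) = 0\<close>, where \<open>\<zeta>\<close> is a tangent vector
  at \<open>Xs\<close> close to \<open>\<eta>\<close>; the projection, the form and the vector each contribute an error with a
  factor \<open>norm (X - Xs)\<close>.\<close>

lemma vanishing_model:
  assumes calm: "calm_bilinear Xs B" and van: "\<forall>\<zeta>\<in>TS Xs. Proj Xs (B Xs \<zeta> \<zeta>) = 0"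
  obtains c where "0 \<le> c" "\<forall>\<^sub>F X in nhds Xs. X \<in> M \<longrightarrow>
    (\<forall>\<eta>\<in>TS X. norm (Proj X (B X \<eta> \<eta>)) \<le> c * norm (X - Xs) * norm \<eta> ^ 2)"
proof -
  obtain b where b: "0 \<le> b" and B: "\<forall>\<^sub>F X in nhds Xs. bilinear (B X)
     \<and> (\<forall>u v. norm (B X u v) \<le> b * norm u * norm v)
     \<and> (\<forall>u v. norm (B X u v - B Xs u v) \<le> b * norm (X - Xs) * norm u * norm v)"
    using calm unfolding calm_bilinear_def by blast
  note B0 = eventually_nhds_x_imp_x[OF B]
  let ?p = "norm (Proj Xs)" and ?t = "c0 * KC"
  have t: "0 \<le> ?t" using c0(1) CT.K_nonneg by simp
  let ?c = "KP * b + ?p * b + ?p * (b * ?t * (3 + ?t))"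
  have "\<forall>\<^sub>F X in nhds Xs. X \<in> M \<longrightarrow>
    (\<forall>\<eta>\<in>TS X. norm (Proj X (B X \<eta> \<eta>)) \<le> ?c * norm (X - Xs) * norm \<eta> ^ 2)"
    using B KP tangent_transfer eventually_small[of 1 1 Xs, simplified]
  proof eventually_elim
    case (elim X)
    show ?case
    proof (intro impI ballI)
      fix \<eta> assume X: "X \<in> M" and \<eta>: "\<eta> \<in> TS X"
      let ?e = "norm (X - Xs)" and ?n = "norm \<eta>"
      obtain \<zeta> where \<zeta>: "\<zeta> \<in> TS Xs" and diff: "norm (\<eta> - \<zeta>) \<le> ?t * ?e * ?n"
        using elim(3) \<eta> by blast
      have "?t * ?e * ?n \<le> ?t * 1 * ?n" using elim(4) t by (intro mult_right_mono mult_left_mono) auto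
      then have n\<zeta>: "norm \<zeta> \<le> (1 + ?t) * ?n"
        using diff norm_triangle_ineq3[of \<eta> \<zeta>] norm_triangle_sub[of \<zeta> \<eta>]
        by (simp add: distrib_right norm_minus_commute)
      have lin: "B Xs (u - v) w = B Xs u w - B Xs v w" "B Xs w (u - v) = B Xs w u - B Xs w v" for u v w
        using B0 by (simp_all add: bilinear_lsub bilinear_rsub)
      have "B Xs \<eta> \<eta> = B Xs \<zeta> \<zeta> + (B Xs (\<eta> - \<zeta>) \<eta> + B Xs \<zeta> (\<eta> - \<zeta>))"
        by (simp add: lin)
      then have P0: "Proj Xs (B Xs \<eta> \<eta>) = Proj Xs (B Xs (\<eta> - \<zeta>) \<eta> + B Xs \<zeta> (\<eta> - \<zeta>))"
        using van \<zeta> by (simp only: blinfun.add_right) simp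
      have "norm (B Xs (\<eta> - \<zeta>) \<eta>) \<le> b * norm (\<eta> - \<zeta>) * ?n" using B0 by blast
      also have "\<dots> \<le> b * (?t * ?e * ?n) * ?n"
        using diff b by (intro mult_right_mono mult_left_mono) auto
      finally have 1: "norm (B Xs (\<eta> - \<zeta>) \<eta>) \<le> b * (?t * ?e * ?n) * ?n" .
      have "norm (B Xs \<zeta> (\<eta> - \<zeta>)) \<le> b * norm \<zeta> * norm (\<eta> - \<zeta>)" using B0 by blast
      also have "\<dots> \<le> b * ((1 + ?t) * ?n) * (?t * ?e * ?n)"
        using diff b n\<zeta> t by (intro mult_mono mult_left_mono) auto
      finally have "norm (B Xs (\<eta> - \<zeta>) \<eta> + B Xs \<zeta> (\<eta> - \<zeta>))
          \<le> b * (?t * ?e * ?n) * ?n + b * ((1 + ?t) * ?n) * (?t * ?e * ?n)"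
        using 1 by (intro order_trans[OF norm_triangle_ineq add_mono])
      also have "\<dots> = (b * ?t * (2 + ?t)) * (?e * ?n ^ 2)"
        by (simp add: algebra_simps power2_eq_square)
      also have "\<dots> \<le> (b * ?t * (3 + ?t)) * (?e * ?n ^ 2)"
        using b t by (intro mult_right_mono mult_left_mono) auto
      finally have T3: "norm (Proj Xs (B Xs \<eta> \<eta>)) \<le> ?p * ((b * ?t * (3 + ?t)) * (?e * ?n ^ 2))"
        unfolding P0 by (intro norm_blinfun_le order_refl)
      have "norm (B X \<eta> \<eta>) \<le> b * ?n * ?n" "norm (B X \<eta> \<eta> - B Xs \<eta> \<eta>) \<le> b * ?e * ?n * ?n"
        using elim(1) by blast+
      then have T1: "norm ((Proj X - Proj Xs) (B X \<eta> \<eta>)) \<le> (KP * ?e) * (b * ?n * ?n)"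
        and T2: "norm (Proj Xs (B X \<eta> \<eta> - B Xs \<eta> \<eta>)) \<le> ?p * (b * ?e * ?n * ?n)"
        using elim(2) X by (auto intro!: norm_blinfun_le)
      have eq: "Proj X (B X \<eta> \<eta>) = (Proj X - Proj Xs) (B X \<eta> \<eta>) + Proj Xs (B X \<eta> \<eta> - B Xs \<eta> \<eta>)
          + Proj Xs (B Xs \<eta> \<eta>)"
        by (simp add: blinfun.bilinear_simps)
      have "norm (Proj X (B X \<eta> \<eta>)) \<le> norm ((Proj X - Proj Xs) (B X \<eta> \<eta>))
          + norm (Proj Xs (B X \<eta> \<eta> - B Xs \<eta> \<eta>)) + norm (Proj Xs (B Xs \<eta> \<eta>))"
        unfolding eq by (rule order_trans[OF norm_triangle_ineq add_right_mono[OF norm_triangle_ineq]])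
      with T1 T2 T3 have "norm (Proj X (B X \<eta> \<eta>)) \<le> (KP * ?e) * (b * ?n * ?n) + ?p * (b * ?e * ?n * ?n)
          + ?p * ((b * ?t * (3 + ?t)) * (?e * ?n ^ 2))" by linarith
      then show "norm (Proj X (B X \<eta> \<eta>)) \<le> ?c * ?e * ?n ^ 2"
        by (simp add: algebra_simps power2_eq_square)
    qed
  qed
  moreover have "0 \<le> ?c" using KP_nonneg b t by simp
  ultimately show ?thesis using that by blast
qed

theorem newton_converges:
  assumes model: "quadratic_model B" and rep: "represents B G"
    and van: "\<forall>\<zeta>\<in>TS Xs. Proj Xs (G Xs \<zeta>) = 0"
  shows "locally_cubically_convergent C T r (newton_update C Proj F) Xs"
proof -
  have "\<forall>\<zeta>\<in>TS Xs. Proj Xs (B Xs \<zeta> \<zeta>) = 0"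
    using van Xs eventually_nhds_x_imp_x[OF rep[unfolded represents_def]] by simp
  then obtain c where c: "0 \<le> c" "\<forall>\<^sub>F X in nhds Xs. X \<in> M \<longrightarrow>
    (\<forall>\<eta>\<in>TS X. norm (Proj X (B X \<eta> \<eta>)) \<le> c * norm (X - Xs) * norm \<eta> ^ 2)"
    using vanishing_model model unfolding quadratic_model_def by blast
  obtain k where k: "0 \<le> k" and newton: "\<forall>\<^sub>F X in nhds Xs. X \<in> M \<longrightarrow> (\<exists>!\<eta>. newton_update C Proj F X \<eta>) \<and>
    (\<forall>\<eta>. newton_update C Proj F X \<eta> \<longrightarrow>
      \<eta> \<in> TS X \<and> Proj X (F1 X \<eta>) = - F X \<and> norm \<eta> \<le> k * norm (X - Xs))"
    using newton_increment by blast
  have k': "0 \<le> k + c * k\<^sup>2" using k c(1) by simp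
  obtain c' where step: "\<forall>\<^sub>F X in nhds Xs. X \<in> M \<longrightarrow> (\<forall>\<xi>\<in>TS X. norm \<xi> \<le> (k + c * k\<^sup>2) * norm (X - Xs) \<longrightarrow>
    norm (F X + Proj X (F1 X \<xi>) + (1/2) *\<^sub>R Proj X (B X \<xi> \<xi>)) \<le> (k + c * k\<^sup>2) * norm (X - Xs) ^ 3 \<longrightarrow>
    (X, \<xi>) \<in> T \<and> r (X, \<xi>) \<in> M \<and> norm (r (X, \<xi>) - Xs) \<le> c' * norm (X - Xs) ^ 3)"
    using third_order_step[OF model k'] by blast
  show ?thesis
  proof (rule locally_cubically_convergentI)
    show "\<forall>\<^sub>F X in nhds Xs. X \<in> M \<longrightarrow> (\<exists>!\<xi>. newton_update C Proj F X \<xi>) \<and>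
      (\<forall>\<xi>. newton_update C Proj F X \<xi> \<longrightarrow> (X, \<xi>) \<in> T \<and> r (X, \<xi>) \<in> M
        \<and> norm (r (X, \<xi>) - Xs) \<le> c' * norm (X - Xs) ^ 3)"
      using newton step c(2)
    proof eventually_elim
      case (elim X)
      show ?case
      proof (intro impI conjI)
        assume X: "X \<in> M"
        then show "\<exists>!\<xi>. newton_update C Proj F X \<xi>" using elim(1) by blast
        show "\<forall>\<xi>. newton_update C Proj F X \<xi> \<longrightarrow> (X, \<xi>) \<in> T \<and> r (X, \<xi>) \<in> M
          \<and> norm (r (X, \<xi>) - Xs) \<le> c' * norm (X - Xs) ^ 3"
        proof (intro allI impI)
          fix \<xi> assume "newton_update C Proj F X \<xi>"
          then have \<xi>: "\<xi> \<in> TS X" "Proj X (F1 X \<xi>) = - F X" "norm \<xi> \<le> k * norm (X - Xs)"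
            using elim(1) X by blast+
          let ?e = "norm (X - Xs)"
          have a: "norm \<xi> \<le> (k + c * k\<^sup>2) * ?e"
            using \<xi>(3) mult_right_mono[of k "k + c * k\<^sup>2" ?e] c(1) by simp
          have "norm (Proj X (B X \<xi> \<xi>)) \<le> c * ?e * norm \<xi> ^ 2" using elim(3) X \<xi>(1) by blast
          also have "\<dots> \<le> c * ?e * (k * ?e) ^ 2"
            using \<xi>(3) c(1) by (intro mult_left_mono power_mono) auto
          also have "\<dots> = (c * k\<^sup>2) * ?e ^ 3" by (simp add: power2_eq_square power3_eq_cube)
          finally have "norm (Proj X (B X \<xi> \<xi>)) \<le> (c * k\<^sup>2) * ?e ^ 3" .
          moreover have half_le: "norm ((1/2) *\<^sub>R z) \<le> norm z" for z :: 'e by simp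
          moreover have "0 \<le> k * ?e ^ 3" using k by simp
          ultimately have "norm ((1/2) *\<^sub>R Proj X (B X \<xi> \<xi>)) \<le> (k + c * k\<^sup>2) * ?e ^ 3"
            using half_le[of "Proj X (B X \<xi> \<xi>)"] unfolding distrib_right by linarith
          then have "norm (F X + Proj X (F1 X \<xi>) + (1/2) *\<^sub>R Proj X (B X \<xi> \<xi>)) \<le> (k + c * k\<^sup>2) * ?e ^ 3"
            unfolding \<xi>(2) right_minus add_0 .
          with a show "(X, \<xi>) \<in> T \<and> r (X, \<xi>) \<in> M \<and> norm (r (X, \<xi>) - Xs) \<le> c' * ?e ^ 3"
            using elim(2) X \<xi>(1) by blast
        qed
      qed
    qed
  qed
qed

theorem chebyshev_converges:
  assumes model: "quadratic_model B" and rep: "represents B G"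
  shows "locally_cubically_convergent C T r (chebyshev_update C Proj F G) Xs"
proof -
  obtain b where b: "0 \<le> b" and B: "\<forall>\<^sub>F X in nhds Xs. bilinear (B X)
     \<and> (\<forall>u v. norm (B X u v) \<le> b * norm u * norm v)
     \<and> (\<forall>u v. norm (B X u v - B Xs u v) \<le> b * norm (X - Xs) * norm u * norm v)"
    using model unfolding quadratic_model_def calm_bilinear_def by blast
  obtain k where k: "0 \<le> k" and newton: "\<forall>\<^sub>F X in nhds Xs. X \<in> M \<longrightarrow> (\<exists>!\<eta>. newton_update C Proj F X \<eta>) \<and>
    (\<forall>\<eta>. newton_update C Proj F X \<eta> \<longrightarrow>
      \<eta> \<in> TS X \<and> Proj X (F1 X \<eta>) = - F X \<and> norm \<eta> \<le> k * norm (X - Xs))"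
    using newton_increment by blast
  obtain K where K: "0 \<le> K" and inv: "\<forall>\<^sub>F X in nhds Xs. X \<in> M \<longrightarrow> (\<forall>\<eta>\<in>TS X. norm \<eta> \<le> K * norm (Proj X (F1 X \<eta>)))"
    using inverse_bounded by blast
  define p where "p = norm (Proj Xs) + 1"
  define q where "q = K * (p * (b * k * k))"
  define m where "m = k + q + p * (b * q * k + b * k * q + b * q * q)"
  have p: "0 \<le> p" by (simp add: p_def)
  have q: "0 \<le> q" using K p b k by (simp add: q_def)
  have m: "0 \<le> m" "k + q \<le> m" "p * (b * q * k + b * k * q + b * q * q) \<le> m"
    using p q b k by (simp_all add: m_def)
  obtain c' where step: "\<forall>\<^sub>F X in nhds Xs. X \<in> M \<longrightarrow> (\<forall>\<xi>\<in>TS X. norm \<xi> \<le> m * norm (X - Xs) \<longrightarrow>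
    norm (F X + Proj X (F1 X \<xi>) + (1/2) *\<^sub>R Proj X (B X \<xi> \<xi>)) \<le> m * norm (X - Xs) ^ 3 \<longrightarrow>
    (X, \<xi>) \<in> T \<and> r (X, \<xi>) \<in> M \<and> norm (r (X, \<xi>) - Xs) \<le> c' * norm (X - Xs) ^ 3)"
    using third_order_step[OF model m(1)] by blast
  show ?thesis
  proof (rule locally_cubically_convergentI)
    show "\<forall>\<^sub>F X in nhds Xs. X \<in> M \<longrightarrow> (\<exists>!\<xi>. chebyshev_update C Proj F G X \<xi>) \<and>
      (\<forall>\<xi>. chebyshev_update C Proj F G X \<xi> \<longrightarrow> (X, \<xi>) \<in> T \<and> r (X, \<xi>) \<in> M
        \<and> norm (r (X, \<xi>) - Xs) \<le> c' * norm (X - Xs) ^ 3)"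
      using newton step inv solvable B rep[unfolded represents_def] Proj_bounded FT.near
        eventually_small[of 1 1 Xs, simplified]
    proof eventually_elim
      case (elim X)
      show ?case
      proof (intro impI conjI)
        assume X: "X \<in> M"
        have ex1_\<tau>: "\<exists>!\<tau>. solves_projected C Proj F X (Proj X v) \<tau>" for v
          using elim(4) X by blast
        obtain \<eta> where \<eta>: "solves_projected C Proj F X (- F X) \<eta>"
          and \<eta>_unique: "\<And>\<eta>'. solves_projected C Proj F X (- F X) \<eta>' \<Longrightarrow> \<eta>' = \<eta>"
          using elim(1) X unfolding newton_update_def by blast
        obtain \<tau> where \<tau>: "solves_projected C Proj F X (Proj X (G X \<eta>)) \<tau>"
          and \<tau>_unique: "\<And>\<tau>'. solves_projected C Proj F X (Proj X (G X \<eta>)) \<tau>' \<Longrightarrow> \<tau>' = \<tau>"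
          using ex1_\<tau>[of "G X \<eta>"] by blast
        have upd: "chebyshev_update C Proj F G X \<xi> \<longleftrightarrow> \<xi> = \<eta> - (1/2) *\<^sub>R \<tau>" for \<xi>
          unfolding chebyshev_update_def using \<eta> \<tau> \<eta>_unique \<tau>_unique by metis
        then show "\<exists>!\<xi>. chebyshev_update C Proj F G X \<xi>" by simp
        let ?e = "norm (X - Xs)" and ?\<xi> = "\<eta> - (1/2) *\<^sub>R \<tau>"
        have \<eta>': "\<eta> \<in> TS X" "Proj X (F1 X \<eta>) = - F X" "norm \<eta> \<le> k * ?e"
          using elim(1) X \<eta> unfolding newton_update_def by blast+
        have \<tau>': "\<tau> \<in> TS X" "Proj X (F1 X \<tau>) = Proj X (B X \<eta> \<eta>)"
          using \<tau> elim(6) X \<eta>'(1) by (simp_all add: solves_projected_def F1_eq[OF elim(8)])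
        have normP: "norm (Proj X) \<le> p" using elim(7) X by (simp add: p_def)
        have Bb: "norm (B X u v) \<le> b * norm u * norm v" for u v using elim(5) by blast
        have "norm \<tau> \<le> K * norm (Proj X (B X \<eta> \<eta>))" using elim(3) X \<tau>' by metis
        also have "\<dots> \<le> K * (p * (b * norm \<eta> * norm \<eta>))"
          by (intro mult_left_mono norm_blinfun_le normP Bb K)
        also have "\<dots> \<le> K * (p * (b * (k * ?e) * (k * ?e)))"
          using \<eta>'(3) b k by (intro mult_left_mono mult_mono K p) auto
        also have "\<dots> = q * ?e\<^sup>2" by (simp add: q_def power2_eq_square)
        finally have \<tau>2: "norm \<tau> \<le> q * ?e\<^sup>2" .
        have "?e\<^sup>2 \<le> ?e" using elim(9) by (simp add: power2_eq_square mult_left_le_one_le)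
        then have "q * ?e\<^sup>2 \<le> q * ?e" using q by (rule mult_left_mono)
        with \<tau>2 have \<tau>1: "norm \<tau> \<le> q * ?e" by simp
        have TS: "?\<xi> \<in> TS X" using \<eta>'(1) \<tau>'(1) subspace_TS by (simp add: subspace_diff subspace_scale)
        have "norm ?\<xi> \<le> norm \<eta> + norm \<tau>"
        proof -
          have "norm ((1/2) *\<^sub>R \<tau>) \<le> norm \<tau>" by simp
          then show ?thesis using norm_triangle_ineq4[of \<eta> "(1/2) *\<^sub>R \<tau>"] by linarith
        qed
        also have "\<dots> \<le> (k + q) * ?e" using \<eta>'(3) \<tau>1 by (simp add: distrib_right)
        also have "\<dots> \<le> m * ?e" using m(2) by (rule mult_right_mono) simp
        finally have small: "norm ?\<xi> \<le> m * ?e" .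
        \<comment> \<open>What remains of the quadratic term after the correction; each summand contains \<open>\<tau>\<close>, which is quadratically small.\<close>
        let ?R = "(1/4) *\<^sub>R B X \<tau> \<tau> - (1/2) *\<^sub>R (B X \<tau> \<eta> + B X \<eta> \<tau>)"
        have lin: "B X (u - v) w = B X u w - B X v w" "B X w (u - v) = B X w u - B X w v"
            "B X (a *\<^sub>R u) w = a *\<^sub>R B X u w" "B X w (a *\<^sub>R u) = a *\<^sub>R B X w u" for u v w a
          using elim(5) by (simp_all add: bilinear_lsub bilinear_rsub bilinear_lmul bilinear_rmul)
        have "B X ?\<xi> ?\<xi> = B X \<eta> \<eta> + ?R"
          by (simp add: lin scaleR_diff_right scaleR_add_right)
        then have defect: "F X + Proj X (F1 X ?\<xi>) + (1/2) *\<^sub>R Proj X (B X ?\<xi> ?\<xi>) = (1/2) *\<^sub>R Proj X ?R"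
          by (simp add: blinfun.diff_right blinfun.scaleR_right blinfun.add_right \<eta>'(2) \<tau>'(2) scaleR_add_right
              del: scaleR_diff_right)
        have "norm (B X \<tau> \<eta>) \<le> b * (q * ?e\<^sup>2) * (k * ?e)"
          using b q by (intro order_trans[OF Bb] mult_mono mult_left_mono \<tau>2 \<eta>'(3)) auto
        moreover have "norm (B X \<eta> \<tau>) \<le> b * (k * ?e) * (q * ?e\<^sup>2)"
          using b k by (intro order_trans[OF Bb] mult_mono mult_left_mono \<tau>2 \<eta>'(3)) auto
        moreover have "norm (B X \<tau> \<tau>) \<le> b * (q * ?e\<^sup>2) * (q * ?e)"
          using b q by (intro order_trans[OF Bb] mult_mono mult_left_mono \<tau>2 \<tau>1) auto
        moreover have "norm ?R \<le> norm (B X \<tau> \<tau>) + (norm (B X \<tau> \<eta>) + norm (B X \<eta> \<tau>))"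
        proof -
          have "norm ?R \<le> norm ((1/4) *\<^sub>R B X \<tau> \<tau>) + norm ((1/2) *\<^sub>R (B X \<tau> \<eta> + B X \<eta> \<tau>))"
            by (rule norm_triangle_ineq4)
          moreover have "norm ((1/4) *\<^sub>R B X \<tau> \<tau>) \<le> norm (B X \<tau> \<tau>)" by simp
          moreover have "norm ((1/2) *\<^sub>R (B X \<tau> \<eta> + B X \<eta> \<tau>)) \<le> norm (B X \<tau> \<eta> + B X \<eta> \<tau>)" by simp
          moreover have "norm (B X \<tau> \<eta> + B X \<eta> \<tau>) \<le> norm (B X \<tau> \<eta>) + norm (B X \<eta> \<tau>)"
            by (rule norm_triangle_ineq)
          ultimately show ?thesis by linarith
        qed
        ultimately have "norm ?R \<le> b * (q * ?e\<^sup>2) * (q * ?e) + (b * (q * ?e\<^sup>2) * (k * ?e) + b * (k * ?e) * (q * ?e\<^sup>2))"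
          by linarith
        also have "\<dots> = (b * q * k + b * k * q + b * q * q) * ?e ^ 3"
          by (simp add: power2_eq_square power3_eq_cube distrib_right)
        finally have "norm (Proj X ?R) \<le> p * ((b * q * k + b * k * q + b * q * q) * ?e ^ 3)"
          by (intro norm_blinfun_le normP)
        also have "\<dots> \<le> m * ?e ^ 3"
          using mult_right_mono[OF m(3), of "?e ^ 3"] by (simp add: mult.assoc)
        finally have "norm (Proj X ?R) \<le> m * ?e ^ 3" .
        moreover have "norm ((1/2) *\<^sub>R Proj X ?R) \<le> norm (Proj X ?R)" by simp
        ultimately have "norm (F X + Proj X (F1 X ?\<xi>) + (1/2) *\<^sub>R Proj X (B X ?\<xi> ?\<xi>)) \<le> m * ?e ^ 3"
          unfolding defect by linarith
        then have "(X, ?\<xi>) \<in> T \<and> r (X, ?\<xi>) \<in> M \<and> norm (r (X, ?\<xi>) - Xs) \<le> c' * ?e ^ 3"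
          using elim(2) X TS small by blast
        then show "\<forall>\<xi>. chebyshev_update C Proj F G X \<xi> \<longrightarrow> (X, \<xi>) \<in> T \<and> r (X, \<xi>) \<in> M
          \<and> norm (r (X, \<xi>) - Xs) \<le> c' * ?e ^ 3"
          by (simp only: upd) simp
      qed
    qed
  qed
qed

end

section \<open>The quadratic models\<close>

definition inl_blinfun :: "'a::real_normed_vector \<Rightarrow>\<^sub>L ('a \<times> 'b::real_normed_vector)" where
  "inl_blinfun = Blinfun (\<lambda>v. (v, 0))"

definition inr_blinfun :: "'b::real_normed_vector \<Rightarrow>\<^sub>L ('a::real_normed_vector \<times> 'b)" where
  "inr_blinfun = Blinfun (\<lambda>v. (0, v))"

lemma inl_blinfun_apply [simp]: "inl_blinfun v = (v, 0)"
  unfolding inl_blinfun_def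
  by (subst bounded_linear_Blinfun_apply) (auto intro: bounded_linear_Pair bounded_linear_ident bounded_linear_zero)

lemma inr_blinfun_apply [simp]: "inr_blinfun v = (0, v)"
  unfolding inr_blinfun_def
  by (subst bounded_linear_Blinfun_apply) (auto intro: bounded_linear_Pair bounded_linear_ident bounded_linear_zero)

context newton_local
begin

lemma calm_retraction: "calm_bilinear Xs (\<lambda>X u v. g2 (X, 0) (0, u) (0, v))"
proof -
  have "calm_at (\<lambda>X::'e. (X, 0::'e)) Xs"
    unfolding calm_at_def by (intro exI[of _ 1]) simp
  then have "calm_at (\<lambda>X. g2 (X, 0)) Xs" by (rule gT.calm_compose) simp
  from calm_bilinear_quadratic[OF this calm_at_const[of inr_blinfun]] show ?thesis by simp
qed

definition "BG X u v = F2 X u v + F1 X (g2 (X, 0) (0, u) (0, v))"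

lemma BG_calm: "calm_bilinear Xs BG"
  unfolding BG_def
  using calm_bilinear_add[OF _ calm_bilinear_apply[OF FT.calm(2) calm_retraction]]
    calm_bilinear_quadratic[OF FT.calm(3) calm_at_const[of id_blinfun]]
  by simp

lemma BG_represents: "represents BG (G_form C r F)"
  unfolding represents_def
  using FT.near eventually_small[OF rho(1), of 1 Xs]
proof eventually_elim
  case (elim X)
  show ?case
  proof (intro impI ballI)
    fix \<eta> assume X: "X \<in> M" and \<eta>: "\<eta> \<in> TS X"
    have "((\<lambda>Y. F1 Y \<eta>) has_derivative (\<lambda>v. F2 X v \<eta>)) (at X)"
      using FT.D2[OF elim(1)] by (auto intro!: derivative_eq_intros)
    then have "second_derivative F UNIV X \<eta> \<eta> = F2 X \<eta> \<eta>"
      by (intro second_derivative_eq[where U = "ball Xs dF" and h = F and ?h1.0 = "\<lambda>Y. blinfun_apply (F1 Y)"]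
          subspace_UNIV open_ball UNIV_I elim(1) FT.D1 refl)
    moreover have "retraction_etaeta C r X \<eta> = g2 (X, 0) (0, \<eta>) (0, \<eta>)"
      using retraction_etaeta_eq[OF X _ \<eta>] elim(2) by simp
    ultimately show "G_form C r F X \<eta> = BG X \<eta> \<eta>"
      by (simp add: G_form_def BG_def F1_eq[OF elim(1)])
  qed
qed

lemma Kg1: "0 < Kg + 1" using gT.K_nonneg by simp

lemma retraction_near:
  assumes "0 < \<delta>"
  shows "\<exists>\<rho>'. 0 < \<rho>' \<and> \<rho>' \<le> \<rho> \<and> (\<forall>\<^sub>F X in nhds Xs. X \<in> M \<longrightarrow>
    (\<forall>\<xi>\<in>TS X. norm \<xi> < \<rho>' \<longrightarrow> norm (r (X, \<xi>) - Xs) < \<delta>))"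
proof (intro exI conjI)
  let ?\<rho>' = "min \<rho> (\<delta> / (2 * (Kg + 1)))"
  show "0 < ?\<rho>'" using rho(1) assms Kg1 by simp
  show "?\<rho>' \<le> \<rho>" by simp
  have "0 < \<delta> / 2" using assms by simp
  from eventually_small[OF this, of 1 Xs] eventually_small[OF rho(1), of 1 Xs]
  show "\<forall>\<^sub>F X in nhds Xs. X \<in> M \<longrightarrow> (\<forall>\<xi>\<in>TS X. norm \<xi> < ?\<rho>' \<longrightarrow> norm (r (X, \<xi>) - Xs) < \<delta>)"
  proof eventually_elim
    case (elim X)
    show ?case
    proof (intro impI ballI)
      fix \<xi> assume X: "X \<in> M" and \<xi>: "\<xi> \<in> TS X" "norm \<xi> < ?\<rho>'"
      have "norm (r (X, \<xi>) - X) \<le> Kg * norm \<xi>"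
        using retraction_expansion(1)[OF X _ \<xi>(1)] elim(2) \<xi>(2) by simp
      also have "\<dots> \<le> (Kg + 1) * norm \<xi>" by (simp add: mult_right_mono)
      also have "\<dots> < \<delta> / 2"
      proof -
        have "norm \<xi> < \<delta> / (2 * (Kg + 1))" using \<xi>(2) by simp
        then show ?thesis using Kg1 by (simp add: field_simps)
      qed
      finally show "norm (r (X, \<xi>) - Xs) < \<delta>"
        using norm_triangle_ineq[of "r (X, \<xi>) - X" "X - Xs"] elim(1) by simp
    qed
  qed
qed

text \<open>Substituting the expansion \<open>X + \<xi> + 1/2 q\<close> of the retraction, with \<open>q = g2 (X, 0) (0, \<xi>) (0, \<xi>)\<close>,
  into the expansion of \<open>F\<close> yields the quadratic terms \<open>F2 X \<xi> \<xi>\<close> and \<open>F1 X q\<close> of \<open>BG\<close>.\<close>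

lemma BG_model: "quadratic_model BG"
proof -
  obtain \<rho>' where \<rho>': "0 < \<rho>'" "\<rho>' \<le> \<rho>" and near:
    "\<forall>\<^sub>F X in nhds Xs. X \<in> M \<longrightarrow> (\<forall>\<xi>\<in>TS X. norm \<xi> < \<rho>' \<longrightarrow> norm (r (X, \<xi>) - Xs) < dF)"
    using retraction_near[OF FT.d_pos] by blast
  let ?k = "Kg + 1" and ?p = "norm (Proj Xs) + 1"
  let ?c = "KF * ?k ^ 3 + KF * ?k\<^sup>2 + KF * Kg"
  have "\<forall>\<^sub>F X in nhds Xs. X \<in> M \<longrightarrow> (\<forall>\<xi>\<in>TS X. norm \<xi> < \<rho>' \<longrightarrow>
        norm (Proj X (F (r (X, \<xi>))) - (F X + Proj X (F1 X \<xi>) + (1/2) *\<^sub>R Proj X (BG X \<xi> \<xi>)))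
          \<le> (?p * ?c) * norm \<xi> ^ 3)"
    using near FT.near Proj_bounded eventually_small[OF rho(1), of 1 Xs]
  proof eventually_elim
    case (elim X)
    show ?case
    proof (intro impI ballI)
      fix \<xi> assume X: "X \<in> M" and \<xi>: "\<xi> \<in> TS X" "norm \<xi> < \<rho>'"
      let ?Y = "r (X, \<xi>)" and ?s = "norm \<xi>"
      let ?q = "g2 (X, 0) (0, \<xi>) (0, \<xi>)"
      have e\<rho>: "norm (X - Xs) < \<rho>" "?s < \<rho>" using elim(4) \<xi>(2) \<rho>'(2) by auto
      note ex = retraction_expansion[OF X e\<rho>(1) \<xi>(1) e\<rho>(2)]
      have Y: "?Y \<in> ball Xs dF" using elim(1) X \<xi> by (simp add: dist_norm norm_minus_commute)
      define D where "D = F ?Y - F X - F1 X (?Y - X) - (1/2) *\<^sub>R F2 X \<xi> \<xi>"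
      define E where "E = F1 X (?Y - X - \<xi> - (1/2) *\<^sub>R ?q)"
      have "norm D \<le> (KF * ?k ^ 3 + KF * ?k\<^sup>2) * ?s ^ 3"
        unfolding D_def
      proof (rule FT.taylor2_perturbed[OF elim(2) Y])
        show "norm (?Y - X) \<le> ?k * ?s"
          by (rule order_trans[OF ex(1)]) (simp add: mult_right_mono)
        show "norm \<xi> \<le> ?k * ?s" using gT.K_nonneg by (simp add: distrib_right)
        show "norm (?Y - X - \<xi>) \<le> ?k * ?s\<^sup>2"
          by (rule order_trans[OF ex(2)]) (simp add: mult_right_mono)
      qed (use Kg1 in auto)
      moreover have "norm E \<le> KF * (Kg * ?s ^ 3)"
        unfolding E_def by (intro norm_blinfun_le FT.bound1 elim(2) ex(3))
      ultimately have "norm (D + E) \<le> ?c * ?s ^ 3"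
        using norm_triangle_ineq[of D E] by (simp add: distrib_right mult.assoc)
      then have "norm (Proj X (D + E)) \<le> ?p * (?c * ?s ^ 3)"
        using elim(3) X by (intro norm_blinfun_le) auto
      moreover have "D + E = F ?Y - F X - F1 X \<xi> - (1/2) *\<^sub>R BG X \<xi> \<xi>"
        unfolding D_def E_def BG_def by (simp add: blinfun.diff_right blinfun.scaleR_right scaleR_add_right)
      moreover have "Proj X (F X) = F X" using Proj_F X by blast
      ultimately show "norm (Proj X (F ?Y) - (F X + Proj X (F1 X \<xi>) + (1/2) *\<^sub>R Proj X (BG X \<xi> \<xi>)))
          \<le> (?p * ?c) * ?s ^ 3"
        by (simp add: blinfun.diff_right blinfun.add_right blinfun.scaleR_right diff_diff_eq mult.assoc add.assoc)
    qed
  qed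
  moreover have "0 \<le> ?p * ?c" using FT.K_nonneg gT.K_nonneg by simp
  ultimately show ?thesis unfolding quadratic_model_def using BG_calm \<rho>'(1) by blast
qed

end

section \<open>Generalized Rayleigh quotients\<close>

locale rayleigh_local = newton_local C Proj F N Xs T r C1 C2 dC KC F1 F2 dF KF g g1 g2 dg Kg KP \<rho>
    + LT: taylor_ball L L1 L2 "(Xs, R Xs)" dL KL + RT: taylor_ball R R1 R2 Xs dR KR
  for C :: "'e::euclidean_space \<Rightarrow> 'l::real_inner" and Proj F N Xs T r
    and C1 C2 dC KC F1 F2 dF KF g g1 g2 dg Kg KP \<rho>
    and L :: "'e \<times> 'l \<Rightarrow> 'e" and L1 L2 dL KL and R :: "'e \<Rightarrow> 'l" and R1 R2 dR KR +
  fixes Lm :: "'e \<times> 'l \<Rightarrow> 'e \<Rightarrow>\<^sub>L 'l"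
  assumes gr: "generalized_rayleigh C Proj F L Lm R"
begin

lemma F_eq_L: "X \<in> M \<Longrightarrow> F X = L (X, R X)"
  using gr unfolding generalized_rayleigh_def by blast

lemma calm_graph: "calm_at (\<lambda>X. (X, R X)) Xs"
proof -
  have "\<forall>\<^sub>F X in nhds Xs. norm ((X, R X) - (Xs, R Xs)) \<le> (1 + KR) * norm (X - Xs)"
    using RT.near
  proof eventually_elim
    case (elim X)
    have "norm (X - Xs, R X - R Xs) \<le> norm (X - Xs) + norm (R X - R Xs)" by (rule norm_Pair_le)
    then show ?case using RT.lip0[OF RT.center elim] by (simp add: distrib_right)
  qed
  then show ?thesis unfolding calm_at_def using RT.K_nonneg by (intro exI[of _ "1 + KR"]) simp
qed

lemmas calm_L = LT.calm_compose[OF calm_graph refl]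

lemma L_partial_X:
  assumes "(X, l) \<in> ball (Xs, R Xs) dL"
  shows "((\<lambda>Y. L (Y, l)) has_derivative (\<lambda>w. L1 (X, l) (w, 0))) (at X)"
    and "((\<lambda>Y. L1 (Y, l) p) has_derivative (\<lambda>w. L2 (X, l) (w, 0) p)) (at X)"
proof -
  have pair: "((\<lambda>Y. (Y, l)) has_derivative (\<lambda>w. (w, 0))) (at X)"
    by (auto intro!: derivative_eq_intros)
  show "((\<lambda>Y. L (Y, l)) has_derivative (\<lambda>w. L1 (X, l) (w, 0))) (at X)"
    by (rule has_derivative_compose[OF pair LT.D1[OF assms]])
  have "((\<lambda>Y. L1 (Y, l)) has_derivative (\<lambda>w. L2 (X, l) (w, 0))) (at X)"
    by (rule has_derivative_compose[OF pair LT.D2[OF assms]])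
  then show "((\<lambda>Y. L1 (Y, l) p) has_derivative (\<lambda>w. L2 (X, l) (w, 0) p)) (at X)"
    by (auto intro!: derivative_eq_intros)
qed

lemma L_partial_lam:
  assumes "(X, l) \<in> ball (Xs, R Xs) dL"
  shows "((\<lambda>m. L (X, m)) has_derivative (\<lambda>w. L1 (X, l) (0, w))) (at l)"
    and "((\<lambda>m. L1 (X, m) p) has_derivative (\<lambda>w. L2 (X, l) (0, w) p)) (at l)"
proof -
  have pair: "((\<lambda>m. (X, m)) has_derivative (\<lambda>w. (0, w))) (at l)"
    by (auto intro!: derivative_eq_intros)
  show "((\<lambda>m. L (X, m)) has_derivative (\<lambda>w. L1 (X, l) (0, w))) (at l)"
    by (rule has_derivative_compose[OF pair LT.D1[OF assms]])
  have "((\<lambda>m. L1 (X, m)) has_derivative (\<lambda>w. L2 (X, l) (0, w))) (at l)"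
    by (rule has_derivative_compose[OF pair LT.D2[OF assms]])
  then show "((\<lambda>m. L1 (X, m) p) has_derivative (\<lambda>w. L2 (X, l) (0, w) p)) (at l)"
    by (auto intro!: derivative_eq_intros)
qed

lemma deriv_lam_eq:
  assumes "(X, l) \<in> ball (Xs, R Xs) dL"
  shows "deriv_lam L X l \<mu> = L1 (X, l) (0, \<mu>)"
  unfolding deriv_lam_def using frechet_derivative_at[OF L_partial_lam(1)[OF assms]] by metis

lemma deriv_X_eq:
  assumes "(X, l) \<in> ball (Xs, R Xs) dL"
  shows "deriv_X L X l \<eta> = L1 (X, l) (\<eta>, 0)"
  unfolding deriv_X_def using frechet_derivative_at[OF L_partial_X(1)[OF assms]] by metis

lemma open_slices:
  "open {Y. (Y, l) \<in> ball (Xs, R Xs) dL}" "open {m. (X, m) \<in> ball (Xs, R Xs) dL}"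
proof -
  have "open ((\<lambda>Y. (Y, l)) -` ball (Xs, R Xs) dL)" "open (Pair X -` ball (Xs, R Xs) dL)"
    by (intro open_vimage continuous_intros open_ball)+
  then show "open {Y. (Y, l) \<in> ball (Xs, R Xs) dL}" "open {m. (X, m) \<in> ball (Xs, R Xs) dL}"
    by (simp_all only: vimage_def)
qed

lemma deriv_X_lam_eq:
  assumes "(X, l) \<in> ball (Xs, R Xs) dL"
  shows "deriv_X_lam L X l \<eta> \<mu> = L2 (X, l) (\<eta>, 0) (0, \<mu>)"
proof -
  have "((\<lambda>Y. deriv_lam L Y l \<mu>) has_derivative (\<lambda>w. L2 (X, l) (w, 0) (0, \<mu>))) (at X)"
    using L_partial_X(2)[OF assms] open_slices(1)
    by (rule has_derivative_transform_within_open) (use assms deriv_lam_eq in auto)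
  then show ?thesis unfolding deriv_X_lam_def using frechet_derivative_at by metis
qed

lemma second_derivative_X_eq:
  assumes "(X, l) \<in> ball (Xs, R Xs) dL"
  shows "second_derivative (\<lambda>Y. L (Y, l)) UNIV X \<eta> \<eta> = L2 (X, l) (\<eta>, 0) (\<eta>, 0)"
  by (rule second_derivative_eq[OF subspace_UNIV open_slices(1)[of l] UNIV_I _ refl L_partial_X(1)
        L_partial_X(2)[OF assms] UNIV_I UNIV_I]) (use assms in auto)

lemma second_derivative_lam_eq:
  assumes "(X, l) \<in> ball (Xs, R Xs) dL"
  shows "second_derivative (\<lambda>m. L (X, m)) UNIV l \<mu> \<mu> = L2 (X, l) (0, \<mu>) (0, \<mu>)"
  by (rule second_derivative_eq[OF subspace_UNIV open_slices(2)[of X] UNIV_I _ refl L_partial_lam(1)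
        L_partial_lam(2)[OF assms] UNIV_I UNIV_I]) (use assms in auto)

text \<open>The projection has the form \<open>I - L\<^sub>\<lambda> Lm\<close> with \<open>Lm\<close> a left inverse of \<open>L\<^sub>\<lambda>\<close>, hence it annihilates the
  range of \<open>L\<^sub>\<lambda>\<close>.\<close>

lemma Proj_L_lam:
  assumes "X \<in> M" "(X, R X) \<in> ball (Xs, R Xs) dL"
  shows "Proj X (L1 (X, R X) (0, \<mu>)) = 0"
proof -
  obtain W where "\<forall>X\<in>M. (X, R X) \<in> W"
    and "\<forall>(X, l)\<in>W. \<forall>\<mu>. blinfun_apply (Lm (X, l)) (deriv_lam L X l \<mu>) = \<mu>"
    using gr unfolding generalized_rayleigh_def by blast
  then have "Lm (X, R X) (deriv_lam L X (R X) \<mu>) = \<mu>" using assms(1) by fast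
  moreover have "Proj X v = v - deriv_lam L X (R X) (Lm (X, R X) v)" for v
    using gr assms(1) unfolding generalized_rayleigh_def by blast
  ultimately show ?thesis by (simp add: deriv_lam_eq[OF assms(2)])
qed

text \<open>The identity \<open>F X = L (X, R X)\<close> holds on \<open>M\<close> only, so the derivatives may differ in transversal
  directions.  They agree on tangent vectors because both sides can be composed with the
  retraction.\<close>

lemma F1_tangent:
  assumes X: "X \<in> M" "norm (X - Xs) < \<rho>" "X \<in> ball Xs dF" "X \<in> ball Xs dR"
    and XR: "(X, R X) \<in> ball (Xs, R Xs) dL" and \<xi>: "\<xi> \<in> TS X"
  shows "F1 X \<xi> = L1 (X, R X) (\<xi>, R1 X \<xi>)"
proof -
  have 0: "0 \<in> TS X" using subspace_TS by (simp add: subspace_0)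
  note r0 = retraction_0(2,4)[OF X(1,2)]
  have "((\<lambda>\<eta>. F (r (X, \<eta>))) has_derivative (\<lambda>\<eta>. F1 X \<eta>)) (at 0 within TS X)"
    by (rule has_derivative_compose[OF r0(2)]) (simp add: r0(1) FT.D1[OF X(3)])
  then have 1: "((\<lambda>\<eta>. L (r (X, \<eta>), R (r (X, \<eta>)))) has_derivative (\<lambda>\<eta>. F1 X \<eta>)) (at 0 within TS X)"
    by (rule has_derivative_transform_within[OF _ rho(1) 0])
      (use in_domain(4)[OF X(1) _ X(2)] F_eq_L in simp)
  have "((\<lambda>Y. (Y, R Y)) has_derivative (\<lambda>w. (w, R1 X w))) (at X)"
    by (intro has_derivative_Pair has_derivative_ident RT.D1 X(4))
  from has_derivative_compose[OF this LT.D1[OF XR]]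
  have LR: "((\<lambda>Y. L (Y, R Y)) has_derivative (\<lambda>w. L1 (X, R X) (w, R1 X w))) (at X)" .
  have 2: "((\<lambda>\<eta>. L (r (X, \<eta>), R (r (X, \<eta>)))) has_derivative (\<lambda>w. L1 (X, R X) (w, R1 X w))) (at 0 within TS X)"
    by (rule has_derivative_compose[OF r0(2), where g = "\<lambda>Y. L (Y, R Y)"]) (simp add: r0(1) LR)
  from has_derivative_within_subspace_unique[OF subspace_TS 0 \<xi> 1 2] show ?thesis .
qed

definition "BL X u v = L2 (X, R X) (u, R1 X u) (v, R1 X v) + L1 (X, R X) (g2 (X, 0) (0, u) (0, v), 0)"

lemma BL_calm: "calm_bilinear Xs BL"
proof -
  have "calm_at (\<lambda>X. inl_blinfun + (inr_blinfun o\<^sub>L R1 X)) Xs"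
    by (intro calm_at_add calm_at_const calm_at_bounded_linear[OF _ RT.calm(2)]
        bounded_bilinear.bounded_linear_right[OF bounded_bilinear_blinfun_compose])
  from calm_bilinear_quadratic[OF calm_L(2) this]
  have 1: "calm_bilinear Xs (\<lambda>X u v. L2 (X, R X) (u, R1 X u) (v, R1 X v))"
    by (simp add: blinfun.add_left)
  have "calm_at (\<lambda>X. L1 (X, R X) o\<^sub>L inl_blinfun) Xs"
    by (intro calm_at_bounded_linear[OF _ calm_L(1)]
        bounded_bilinear.bounded_linear_left[OF bounded_bilinear_blinfun_compose])
  from calm_bilinear_apply[OF this calm_retraction]
  have 2: "calm_bilinear Xs (\<lambda>X u v. L1 (X, R X) (g2 (X, 0) (0, u) (0, v), 0))"
    by simp
  show ?thesis unfolding BL_def by (rule calm_bilinear_add[OF 1 2])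
qed

text \<open>The mixed term of \<open>GL\<close> occurs with a factor two; here the symmetry of the second derivative of \<open>L\<close>
  enters.\<close>

lemma BL_represents: "represents BL (GL_form C r L R)"
  unfolding represents_def
  using RT.near calm_L(3) eventually_small[OF rho(1), of 1 Xs]
proof eventually_elim
  case (elim X)
  show ?case
  proof (intro impI ballI)
    fix \<eta> assume X: "X \<in> M" and \<eta>: "\<eta> \<in> TS X"
    let ?\<mu> = "R1 X \<eta>" and ?L2 = "\<lambda>u v. blinfun_apply (blinfun_apply (L2 (X, R X)) u) v"
    have R1: "frechet_derivative R (at X) = blinfun_apply (R1 X)"
      using frechet_derivative_at[OF RT.D1[OF elim(1)]] by simp
    have "retraction_etaeta C r X \<eta> = g2 (X, 0) (0, \<eta>) (0, \<eta>)"
      using retraction_etaeta_eq[OF X _ \<eta>] elim(3) by simp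
    then have "GL_form C r L R X \<eta> = ?L2 (\<eta>, 0) (\<eta>, 0) + 2 *\<^sub>R ?L2 (\<eta>, 0) (0, ?\<mu>) + ?L2 (0, ?\<mu>) (0, ?\<mu>)
        + L1 (X, R X) (g2 (X, 0) (0, \<eta>) (0, \<eta>), 0)"
      unfolding GL_form_def Let_def R1
      by (simp only: second_derivative_X_eq[OF elim(2)] second_derivative_lam_eq[OF elim(2)]
          deriv_X_lam_eq[OF elim(2)] deriv_X_eq[OF elim(2)])
    moreover have "?L2 (\<eta>, ?\<mu>) (\<eta>, ?\<mu>) = ?L2 (\<eta>, 0) (\<eta>, 0) + 2 *\<^sub>R ?L2 (\<eta>, 0) (0, ?\<mu>) + ?L2 (0, ?\<mu>) (0, ?\<mu>)"
    proof -
      have "?L2 (a + b) (a + b) = ?L2 a a + 2 *\<^sub>R ?L2 a b + ?L2 b b" for a b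
        using LT.symmetric[OF elim(2), of b a]
        by (simp add: blinfun.add_left blinfun.add_right scaleR_2)
      from this[of "(\<eta>, 0)" "(0, ?\<mu>)"] show ?thesis by simp
    qed
    ultimately show "GL_form C r L R X \<eta> = BL X \<eta> \<eta>" by (simp add: BL_def)
  qed
qed

text \<open>The increment of \<open>(X, R X)\<close> along the retraction agrees with \<open>(\<xi>, R1 X \<xi>)\<close> up to second order, which
  is all that the quadratic term of \<open>L\<close> requires.  In the linear term the component of the increment
  along \<open>\<lambda>\<close> is annihilated by the projection, whatever its size.\<close>

lemma BL_model: "quadratic_model BL"
proof -
  obtain \<delta> where \<delta>: "0 < \<delta>" "\<And>Y. norm (Y - Xs) < \<delta> \<Longrightarrow> Y \<in> ball Xs dR \<and> (Y, R Y) \<in> ball (Xs, R Xs) dL"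
    using eventually_conj[OF RT.near calm_L(3)] unfolding eventually_nhds_metric dist_norm by blast
  obtain \<rho>' where \<rho>': "0 < \<rho>'" "\<rho>' \<le> \<rho>" and near:
    "\<forall>\<^sub>F X in nhds Xs. X \<in> M \<longrightarrow> (\<forall>\<xi>\<in>TS X. norm \<xi> < \<rho>' \<longrightarrow> norm (r (X, \<xi>) - Xs) < \<delta>)"
    using retraction_near[OF \<delta>(1)] by blast
  let ?k = "1 + KR + (Kg + KR * Kg) + KR * Kg\<^sup>2" and ?p = "norm (Proj Xs) + 1"
  let ?c = "KL * ?k ^ 3 + KL * ?k\<^sup>2 + KL * Kg"
  have pos: "0 \<le> KR" "0 \<le> Kg" "0 \<le> KR * Kg" "0 \<le> KR * Kg\<^sup>2"
    using RT.K_nonneg gT.K_nonneg by simp_all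
  have "\<forall>\<^sub>F X in nhds Xs. X \<in> M \<longrightarrow> (\<forall>\<xi>\<in>TS X. norm \<xi> < \<rho>' \<longrightarrow>
        norm (Proj X (F (r (X, \<xi>))) - (F X + Proj X (F1 X \<xi>) + (1/2) *\<^sub>R Proj X (BL X \<xi> \<xi>)))
          \<le> (?p * ?c) * norm \<xi> ^ 3)"
    using near FT.near Proj_bounded eventually_small[OF rho(1), of 1 Xs] eventually_small[OF \<delta>(1), of 1 Xs]
  proof eventually_elim
    case (elim X)
    show ?case
    proof (intro impI ballI)
      fix \<xi> assume X: "X \<in> M" and \<xi>: "\<xi> \<in> TS X" "norm \<xi> < \<rho>'"
      let ?Y = "r (X, \<xi>)" and ?s = "norm \<xi>"
      let ?q = "g2 (X, 0) (0, \<xi>) (0, \<xi>)"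
      have e\<rho>: "norm (X - Xs) < \<rho>" "?s < \<rho>" using elim(4) \<xi>(2) \<rho>'(2) by auto
      note ex = retraction_expansion[OF X e\<rho>(1) \<xi>(1) e\<rho>(2)]
      have XR: "X \<in> ball Xs dR" "(X, R X) \<in> ball (Xs, R Xs) dL"
        using \<delta>(2)[of X] elim(5) by simp_all
      have YR: "?Y \<in> ball Xs dR" "(?Y, R ?Y) \<in> ball (Xs, R Xs) dL"
        using \<delta>(2)[of ?Y] elim(1) X \<xi> by blast+
      let ?x = "(X, R X)" and ?y = "(?Y, R ?Y)" and ?w = "?Y - X" and ?\<Delta> = "R ?Y - R X"
      let ?\<Xi> = "(\<xi>, R1 X \<xi>)"
      have diff: "?y - ?x = (?w, ?\<Delta>)" by simp
      have \<Delta>: "norm ?\<Delta> \<le> KR * (Kg * ?s)"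
        using order_trans[OF RT.lip0[OF XR(1) YR(1)] mult_left_mono[OF ex(1) pos(1)]] .
      define D where "D = L ?y - L ?x - L1 ?x (?y - ?x) - (1/2) *\<^sub>R L2 ?x ?\<Xi> ?\<Xi>"
      define E where "E = L1 ?x (?w - \<xi> - (1/2) *\<^sub>R ?q, 0)"
      have "norm D \<le> (KL * ?k ^ 3 + KL * ?k\<^sup>2) * ?s ^ 3"
        unfolding D_def
      proof (rule LT.taylor2_perturbed[OF XR(2) YR(2)])
        show "0 \<le> ?k" using pos by linarith
        have "norm (?y - ?x) \<le> (Kg + KR * Kg) * ?s"
          unfolding diff using norm_Pair_le[of ?w ?\<Delta>] ex(1) \<Delta> by (simp add: distrib_right)
        also have "\<dots> \<le> ?k * ?s" using pos by (intro mult_right_mono) auto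
        finally show "norm (?y - ?x) \<le> ?k * ?s" .
        have "norm (R1 X \<xi>) \<le> KR * ?s" by (intro norm_blinfun_le RT.bound1 XR order_refl)
        then have "norm ?\<Xi> \<le> (1 + KR) * ?s"
          using norm_Pair_le[of \<xi> "R1 X \<xi>"] by (simp add: distrib_right)
        also have "\<dots> \<le> ?k * ?s" using pos by (intro mult_right_mono) auto
        finally show "norm ?\<Xi> \<le> ?k * ?s" .
        have "norm (?\<Delta> - R1 X ?w) \<le> KR * (Kg * ?s)\<^sup>2"
          using order_trans[OF RT.rem0[OF XR(1) YR(1)] mult_left_mono[OF power_mono[OF ex(1) norm_ge_zero] pos(1)]] .
        moreover have "norm (R1 X (?w - \<xi>)) \<le> KR * (Kg * ?s\<^sup>2)"
          by (intro norm_blinfun_le RT.bound1 XR ex(2))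
        moreover have eq: "?\<Delta> - R1 X \<xi> = (?\<Delta> - R1 X ?w) + R1 X (?w - \<xi>)"
          by (simp add: blinfun.diff_right)
        ultimately have "norm (?\<Delta> - R1 X \<xi>) \<le> KR * (Kg * ?s)\<^sup>2 + KR * (Kg * ?s\<^sup>2)"
          unfolding eq using norm_triangle_ineq[of "?\<Delta> - R1 X ?w" "R1 X (?w - \<xi>)"] by linarith
        moreover have eq': "?y - ?x - ?\<Xi> = (?w - \<xi>, ?\<Delta> - R1 X \<xi>)" by simp
        ultimately have "norm (?y - ?x - ?\<Xi>) \<le> ((Kg + KR * Kg) + KR * Kg\<^sup>2) * ?s\<^sup>2"
          unfolding eq' using norm_Pair_le[of "?w - \<xi>" "?\<Delta> - R1 X \<xi>"] ex(2)
          unfolding power_mult_distrib distrib_right mult.assoc by linarith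
        also have "\<dots> \<le> ?k * ?s\<^sup>2" using pos by (intro mult_right_mono) auto
        finally show "norm (?y - ?x - ?\<Xi>) \<le> ?k * ?s\<^sup>2" .
      qed simp
      moreover have "norm E \<le> KL * (Kg * ?s ^ 3)"
        unfolding E_def using ex(3) by (intro norm_blinfun_le LT.bound1 XR) simp
      ultimately have "norm (D + E) \<le> ?c * ?s ^ 3"
        using norm_triangle_ineq[of D E] unfolding distrib_right mult.assoc by linarith
      then have bound: "norm (Proj X (D + E)) \<le> ?p * (?c * ?s ^ 3)"
        using elim(3) X by (intro norm_blinfun_le) auto
      have "L1 ?x (a, b) = L1 ?x (a, 0) + L1 ?x (0, b)" for a b
        by (simp flip: blinfun.add_right)
      note split = this[of ?w ?\<Delta>] this[of \<xi> "R1 X \<xi>"]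
      have lin: "L1 ?x (a - b, 0) = L1 ?x (a, 0) - L1 ?x (b, 0)" "L1 ?x (c *\<^sub>R a, 0) = c *\<^sub>R L1 ?x (a, 0)" for a b c
        using blinfun.diff_right[of "L1 ?x" "(a, 0)" "(b, 0)"] blinfun.scaleR_right[of "L1 ?x" c "(a, 0)"]
        by simp_all
      have Y: "F ?Y = L ?y" "F X = L ?x" using F_eq_L X in_domain(4)[OF X \<xi>(1) e\<rho>] by auto
      have D: "D = F ?Y - F X - (L1 ?x (?w, 0) + L1 ?x (0, ?\<Delta>)) - (1/2) *\<^sub>R L2 ?x ?\<Xi> ?\<Xi>"
        unfolding D_def diff split(1) Y ..
      have E: "E = L1 ?x (?w, 0) - L1 ?x (\<xi>, 0) - (1/2) *\<^sub>R L1 ?x (?q, 0)"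
        unfolding E_def by (simp only: lin)
      have "D + E = F ?Y - F X - L1 ?x (\<xi>, 0) - (1/2) *\<^sub>R BL X \<xi> \<xi> - L1 ?x (0, ?\<Delta>)"
        unfolding D E BL_def by (simp only: scaleR_add_right) simp
      then have "Proj X (D + E) = Proj X (F ?Y) - Proj X (F X) - Proj X (L1 ?x (\<xi>, 0))
          - (1/2) *\<^sub>R Proj X (BL X \<xi> \<xi>)"
        by (simp add: blinfun.diff_right blinfun.scaleR_right Proj_L_lam[OF X XR(2)])
      moreover have "Proj X (F1 X \<xi>) = Proj X (L1 ?x (\<xi>, 0))"
        unfolding F1_tangent[OF X e\<rho>(1) elim(2) XR \<xi>(1)] split(2)
        by (simp add: blinfun.add_right Proj_L_lam[OF X XR(2)])
      moreover have "Proj X (F X) = F X" using Proj_F X by blast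
      ultimately have "Proj X (D + E) = Proj X (F ?Y) - (F X + Proj X (F1 X \<xi>) + (1/2) *\<^sub>R Proj X (BL X \<xi> \<xi>))"
        by (simp only: diff_diff_eq)
      then show "norm (Proj X (F ?Y) - (F X + Proj X (F1 X \<xi>) + (1/2) *\<^sub>R Proj X (BL X \<xi> \<xi>)))
          \<le> (?p * ?c) * ?s ^ 3"
        using bound by (simp only: mult.assoc)
    qed
  qed
  moreover have "0 \<le> ?p * ?c"
  proof -
    have "0 \<le> ?k" using pos by linarith
    then show ?thesis using LT.K_nonneg pos(2) by simp
  qed
  ultimately show ?thesis unfolding quadratic_model_def using BL_calm \<rho>'(1) by blast
qed

end

section \<open>Convergence of the Newton and the Rayleigh-Chebyshev iterations\<close>

context newton_setting
begin

lemma local_data: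
  obtains C1 C2 dC KC F1 F2 dF KF g g1 g2 dg Kg KP \<rho>
  where "newton_local C Proj F N Xs T r C1 C2 dC KC F1 F2 dF KF g g1 g2 dg Kg KP \<rho>"
proof -
  obtain C1 C2 dC KC where C: "taylor_ball C C1 C2 Xs dC KC"
    by (rule C3_on_taylor_ball[OF C_C3 UNIV_I])
  obtain F1 F2 dF KF where F: "taylor_ball F F1 F2 Xs dF KF"
    by (rule C3_on_taylor_ball[OF F_C3 subsetD[OF N Xs]])
  obtain KP where KP: "0 \<le> KP" "\<forall>\<^sub>F X in nhds Xs. X \<in> M \<longrightarrow> norm (Proj X - Proj Xs) \<le> KP * norm (X - Xs)"
    by (rule Proj_calm)
  obtain g g1 g2 dg Kg \<rho> where g: "taylor_ball g g1 g2 (Xs, 0) dg Kg" and \<rho>: "0 < \<rho>" "2 * \<rho> \<le> dg"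
    "\<forall>X\<in>M. \<forall>\<xi>\<in>TS X. norm (X - Xs) < \<rho> \<longrightarrow> norm \<xi> < \<rho> \<longrightarrow>
      (X, \<xi>) \<in> T \<and> r (X, \<xi>) = g (X, \<xi>)"
    by (rule retraction_taylor)
  have "newton_local_axioms C Proj Xs T r g dg KP \<rho>"
    by (rule newton_local_axioms.intro[OF KP \<rho>])
  from newton_local.intro[OF newton_setting_axioms C F g this] show ?thesis by (rule that)
qed

lemma rayleigh_data:
  assumes "newton_local C Proj F N Xs T r C1 C2 dC KC F1 F2 dF KF g g1 g2 dg Kg KP \<rho>"
    and gr: "generalized_rayleigh C Proj F L Lm R"
  obtains L1 L2 dL KL R1 R2 dR KR
  where "rayleigh_local C Proj F N Xs T r C1 C2 dC KC F1 F2 dF KF g g1 g2 dg Kg KP \<rho> L L1 L2 dL KL R R1 R2 dR KR Lm"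
proof -
  obtain N' where N': "M \<subseteq> N'" "C3_on N' R" and L: "C3_on UNIV L"
    using gr unfolding generalized_rayleigh_def by blast
  obtain L1 L2 dL KL where L: "taylor_ball L L1 L2 (Xs, R Xs) dL KL"
    by (rule C3_on_taylor_ball[OF L UNIV_I])
  obtain R1 R2 dR KR where R: "taylor_ball R R1 R2 Xs dR KR"
    by (rule C3_on_taylor_ball[OF N'(2) subsetD[OF N'(1) Xs]])
  from rayleigh_local.intro[OF assms(1) L R rayleigh_local_axioms.intro[OF gr]] show ?thesis by (rule that)
qed

lemma G_convergence:
  "(\<forall>\<eta>\<in>TS Xs. Proj Xs (G_form C r F Xs \<eta>) = 0) \<Longrightarrow>
    locally_cubically_convergent C T r (newton_update C Proj F) Xs"
  "locally_cubically_convergent C T r (chebyshev_update C Proj F (G_form C r F)) Xs"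
proof -
  obtain C1 C2 dC KC F1 F2 dF KF g g1 g2 dg Kg KP \<rho>
    where loc: "newton_local C Proj F N Xs T r C1 C2 dC KC F1 F2 dF KF g g1 g2 dg Kg KP \<rho>"
    by (rule local_data)
  interpret newton_local C Proj F N Xs T r C1 C2 dC KC F1 F2 dF KF g g1 g2 dg Kg KP \<rho>
    by (rule loc)
  show "locally_cubically_convergent C T r (newton_update C Proj F) Xs"
    if "\<forall>\<eta>\<in>TS Xs. Proj Xs (G_form C r F Xs \<eta>) = 0"
    using that by (rule newton_converges[OF BG_model BG_represents])
  show "locally_cubically_convergent C T r (chebyshev_update C Proj F (G_form C r F)) Xs"
    by (rule chebyshev_converges[OF BG_model BG_represents])
qed

lemma GL_convergence:
  assumes gr: "generalized_rayleigh C Proj F L Lm R"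
  shows "(\<forall>\<eta>\<in>TS Xs. Proj Xs (GL_form C r L R Xs \<eta>) = 0) \<Longrightarrow>
      locally_cubically_convergent C T r (newton_update C Proj F) Xs"
    and "locally_cubically_convergent C T r (chebyshev_update C Proj F (GL_form C r L R)) Xs"
proof -
  obtain C1 C2 dC KC F1 F2 dF KF g g1 g2 dg Kg KP \<rho>
    where loc: "newton_local C Proj F N Xs T r C1 C2 dC KC F1 F2 dF KF g g1 g2 dg Kg KP \<rho>"
    by (rule local_data)
  obtain L1 L2 dL KL R1 R2 dR KR
    where ray: "rayleigh_local C Proj F N Xs T r C1 C2 dC KC F1 F2 dF KF g g1 g2 dg Kg KP \<rho>
      L L1 L2 dL KL R R1 R2 dR KR Lm"
    by (rule rayleigh_data[OF loc gr])
  interpret rayleigh_local C Proj F N Xs T r C1 C2 dC KC F1 F2 dF KF g g1 g2 dg Kg KP \<rho>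
      L L1 L2 dL KL R R1 R2 dR KR Lm
    by (rule ray)
  show "locally_cubically_convergent C T r (newton_update C Proj F) Xs"
    if "\<forall>\<eta>\<in>TS Xs. Proj Xs (GL_form C r L R Xs \<eta>) = 0"
    using that by (rule newton_converges[OF BL_model BL_represents])
  show "locally_cubically_convergent C T r (chebyshev_update C Proj F (GL_form C r L R)) Xs"
    by (rule chebyshev_converges[OF BL_model BL_represents])
qed

end

theorem claim2:
  fixes C :: "'e::euclidean_space \<Rightarrow> 'l::real_inner"
    and Proj :: "'e \<Rightarrow> 'e \<Rightarrow>\<^sub>L 'e"
    and F :: "'e \<Rightarrow> 'e"
    and N :: "'e set"
    and Xs :: 'e
    and T :: "('e \<times> 'e) set"
    and r :: "'e \<times> 'e \<Rightarrow> 'e"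
  assumes "finite_dimensional TYPE('l)"
    and "C3_on UNIV C"
    and "\<forall>X\<in>constraint_set C. surj (frechet_derivative C (at X))"
    and "projection_function C Proj"
    and "constraint_set C \<subseteq> N" and "C3_on N F"
    and "\<forall>X\<in>constraint_set C. blinfun_apply (Proj X) (F X) = F X"
    and "Xs \<in> constraint_set C" and "F Xs = 0"
    and "retraction_around C T r Xs"
    and "bij_betw (\<lambda>\<eta>. blinfun_apply (Proj Xs) (frechet_derivative F (at Xs) \<eta>))
           (tangent_space C Xs) (range (blinfun_apply (Proj Xs)))"
  shows
    "((\<forall>\<eta>\<in>tangent_space C Xs. blinfun_apply (Proj Xs) (G_form C r F Xs \<eta>) = 0) \<longrightarrow>
        locally_cubically_convergent C T r (newton_update C Proj F) Xs)
     \<and> locally_cubically_convergent C T r (chebyshev_update C Proj F (G_form C r F)) Xs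
     \<and> (\<forall>(L :: 'e \<times> 'l \<Rightarrow> 'e) (Lm :: 'e \<times> 'l \<Rightarrow> 'e \<Rightarrow>\<^sub>L 'l) (R :: 'e \<Rightarrow> 'l).
          generalized_rayleigh C Proj F L Lm R \<longrightarrow>
            ((\<forall>\<eta>\<in>tangent_space C Xs. blinfun_apply (Proj Xs) (GL_form C r L R Xs \<eta>) = 0) \<longrightarrow>
               locally_cubically_convergent C T r (newton_update C Proj F) Xs)
            \<and> locally_cubically_convergent C T r
                (chebyshev_update C Proj F (GL_form C r L R)) Xs)"
proof -
  interpret newton_setting C Proj F N Xs T r
    by (rule newton_setting.intro[OF assms])
  show ?thesis by (intro conjI allI impI G_convergence GL_convergence)
qed

end
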